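(* Let $G$ be a finite group and let $n\geq 1$, $d\geq 2$ be integers. The poset $Q_n^{1\,\mathrm{mod}\,d}(G)$ is a totally semimodular pure poset with rank function \[ \mathrm{rk}(J,\pi)=\begin{cases}\lceil\frac{n}{d}\rceil, & \text{if } J=G\times[n],\\[2pt] \frac{n}{d}-\frac{|\pi|}{d|G|}, & \text{otherwise.}\end{cases} \] Its length is $\lceil\frac{n}{d}\rceil$.
   Context: Write $[n]=\{1,\dots,n\}$. A partition of a finite set $I$ is a set of nonempty disjoint subsets of $I$ (its parts) whose union is $I$; the empty set has exactly one partition, the empty one. The finite group $G$ acts on $G\times[n]$ by left multiplication on the first factor. The Dowling lattice $Q_n(G)$ ($n\ge1$) is the poset of pairs $(J,\pi)$ where $J$ is a $G$-stable subset of $G\times[n]$ and $\pi$ is a partition of $(G\times[n])\setminus J$ whose parts are permuted freely by $G$ (i.e. for all $1\neq g\in G$ and $K\in\pi$, $K\neq g.K\in\pi$). The order is: $(J,\pi)\le(J',\pi')$ iff $J\subseteq J'$ and for every part $K\in\pi$, either $K\subseteq J'$ or $K$ is contained in a single part of $\pi'$. Its minimum $\hat 0$ is $(\emptyset,\{\{(g,m)\}: g\in G, m\in[n]\})$ and its maximum $\hat1$ is $(G\times[n],\emptyset)$. For $n\ge1$, $d\ge2$, $Q_n^{1\,\mathrm{mod}\,d}(G)$ is the sub-poset (with induced order) of $Q_n(G)$ consisting of pairs $(J,\pi)$ such that (1) $|K|\equiv1$ mod $d$ for all $K\in\pi$; and (2) either $\frac{|J|}{|G|}\equiv0$ mod $d$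 or $J=G\times[n]$. A finite bounded poset is pure if all its maximal chains have the same length (number of elements minus one), called its length; the rank of $x$ is the length of $[\hat0,x]$. A bounded poset is semimodular if whenever two distinct elements $u,v$ cover a common element, there is an element covering both $u$ and $v$; it is totally semimodular if all its closed intervals are semimodular. *)

theory Defs
  imports
    Complex_Main
    "HOL-Library.Disjoint_Sets"
    "HOL-Number_Theory.Cong"
    "HOL-Algebra.Order"
    "HOL-Algebra.Coset"
begin

section \<open>Bounded, pure and semimodular posets\<close>

text \<open>
  Posets are HOL-Algebra order records. An induced sub-poset is the same record with a
  smaller carrier.
\<close>

locale bounded_poset =
  partial_order L + weak_partial_order_bottom L + weak_partial_order_top L
  for L (structure)

definition poset_interval :: "('p, 'm) gorder_scheme \<Rightarrow> 'p \<Rightarrow> 'p \<Rightarrow> ('p, 'm) gorder_scheme" where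
  "poset_interval L x y = L\<lparr>carrier := \<lbrace>x..y\<rbrace>\<^bsub>L\<^esub>\<rparr>"

abbreviation maximal_chain :: "('p, 'm) gorder_scheme \<Rightarrow> 'p set \<Rightarrow> bool" where
  "maximal_chain L C \<equiv> pred_on.maxchain (carrier L) (lless L) C"

definition pure_poset :: "('p, 'm) gorder_scheme \<Rightarrow> bool" where
  "pure_poset L \<longleftrightarrow> bounded_poset L \<and> finite (carrier L) \<and>
     (\<forall>C D. maximal_chain L C \<longrightarrow> maximal_chain L D \<longrightarrow> card C - 1 = card D - 1)"

text \<open>
  The next two constants are meaningful only for pure posets. The subtraction does not
  truncate, as maximal chains of a bounded poset are nonempty.
\<close>

definition poset_length :: "('p, 'm) gorder_scheme \<Rightarrow> nat" where
  "poset_length L = (THE l. \<forall>C. maximal_chain L C \<longrightarrow> card C - 1 = l)"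

definition poset_rank :: "('p, 'm) gorder_scheme \<Rightarrow> 'p \<Rightarrow> nat" where
  "poset_rank L x = poset_length (poset_interval L \<bottom>\<^bsub>L\<^esub> x)"

definition covers :: "('p, 'm) gorder_scheme \<Rightarrow> 'p \<Rightarrow> 'p \<Rightarrow> bool" where
  "covers L y x \<longleftrightarrow> x \<in> carrier L \<and> y \<in> carrier L \<and> lless L x y \<and>
     \<not> (\<exists>z\<in>carrier L. lless L x z \<and> lless L z y)"

definition semimodular :: "('p, 'm) gorder_scheme \<Rightarrow> bool" where
  "semimodular L \<longleftrightarrow> bounded_poset L \<and>
     (\<forall>u v w. u \<noteq> v \<and> covers L u w \<and> covers L v w \<longrightarrow> (\<exists>z. covers L z u \<and> covers L z v))"

definition totally_semimodular :: "('p, 'm) gorder_scheme \<Rightarrow> bool" where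
  "totally_semimodular L \<longleftrightarrow> bounded_poset L \<and>
     (\<forall>x\<in>carrier L. \<forall>y\<in>carrier L. le L x y \<longrightarrow> semimodular (poset_interval L x y))"

section \<open>Dowling lattices\<close>

definition dowling_ground :: "('a, 'b) monoid_scheme \<Rightarrow> nat \<Rightarrow> ('a \<times> nat) set" where
  "dowling_ground G n = carrier G \<times> {1..n}"

definition dowling_act :: "('a, 'b) monoid_scheme \<Rightarrow> 'a \<Rightarrow> 'a \<times> nat \<Rightarrow> 'a \<times> nat" where
  "dowling_act G g = (\<lambda>(h, m). (g \<otimes>\<^bsub>G\<^esub> h, m))"

definition dowling_carrier ::
  "('a, 'b) monoid_scheme \<Rightarrow> nat \<Rightarrow> (('a \<times> nat) set \<times> ('a \<times> nat) set set) set" where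
  "dowling_carrier G n = {(J, \<pi>).
     J \<subseteq> dowling_ground G n \<and>
     (\<forall>g\<in>carrier G. dowling_act G g ` J \<subseteq> J) \<and>
     partition_on (dowling_ground G n - J) \<pi> \<and>
     (\<forall>g\<in>carrier G. g \<noteq> \<one>\<^bsub>G\<^esub> \<longrightarrow>
        (\<forall>K\<in>\<pi>. dowling_act G g ` K \<noteq> K \<and> dowling_act G g ` K \<in> \<pi>))}"

definition dowling_le ::
  "('a \<times> nat) set \<times> ('a \<times> nat) set set \<Rightarrow> ('a \<times> nat) set \<times> ('a \<times> nat) set set \<Rightarrow> bool" where
  "dowling_le = (\<lambda>(J, \<pi>) (J', \<pi>').
     J \<subseteq> J' \<and> (\<forall>K\<in>\<pi>. K \<subseteq> J' \<or> (\<exists>K'\<in>\<pi>'. K \<subseteq> K')))"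

definition dowling_lattice ::
  "('a, 'b) monoid_scheme \<Rightarrow> nat \<Rightarrow> (('a \<times> nat) set \<times> ('a \<times> nat) set set) gorder" where
  "dowling_lattice G n = \<lparr>carrier = dowling_carrier G n, eq = (=), le = dowling_le\<rparr>"

text \<open>The division by \<open>order G\<close> is exact, since \<open>G\<close> acts freely on the stable set \<open>J\<close>.\<close>

definition dowling_1mod ::
  "nat \<Rightarrow> ('a, 'b) monoid_scheme \<Rightarrow> nat \<Rightarrow> (('a \<times> nat) set \<times> ('a \<times> nat) set set) gorder" where
  "dowling_1mod d G n = (dowling_lattice G n)\<lparr>carrier :=
     {(J, \<pi>) \<in> carrier (dowling_lattice G n).
        (\<forall>K\<in>\<pi>. [card K = 1] (mod d)) \<and>
        ([card J div order G = 0] (mod d) \<or> J = dowling_ground G n)}\<rparr>"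

end

theory Submission
  imports Defs
begin

text \<open>
  An element \<open>(J, \<pi>)\<close> is determined by \<open>\<pi>\<close>. Every step upwards either merges \<open>d + 1\<close> parts from
  distinct \<open>G\<close>-orbits (and, correspondingly, their translates), or absorbs \<open>d\<close> orbits of parts into
  \<open>J\<close>, or jumps to the top when fewer than \<open>d\<close> orbits are left. Each step raises the claimed rank by
  one, and below any larger element there is such a step; this gives purity and the rank function.
  For semimodularity let \<open>u\<close> and \<open>v\<close> be two steps from \<open>w\<close> below \<open>y\<close>. If they touch disjoint sets of
  orbits, perform both. Otherwise the orbits involved all lie in one orbit of parts of \<open>y\<close> or are all
  absorbed in \<open>y\<close>, and the congruences satisfied by \<open>y\<close> leave room for a merge of \<open>2 d + 1\<close> parts or
  an absorption of \<open>2 d\<close> orbits (or for the top) above both \<open>u\<close> and \<open>v\<close> and below \<open>y\<close>.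
\<close>

subsection \<open>Rank functions\<close>

text \<open>Upper bounds of two steps are not canonical: the \<open>2 d + 1\<close> parts to merge
  or the \<open>2 d\<close> orbits to absorb often have to be filled up with further ones, and a
  filling that is incompatible with \<open>y\<close> is useless. Whether there is enough to fill up
  with is decided modulo \<open>d\<close>: a part of \<open>y\<close> contains 1 modulo
  \<open>d\<close> parts of \<open>w\<close>, and \<open>y\<close> absorbs 0 modulo \<open>d\<close>
  orbits of \<open>w\<close>. The second congruence fails at the top, which is exempt from the
  condition on \<open>J\<close>; the ceiling makes up for it, since an element with more than
  \<open>d\<close> and fewer than \<open>2 d\<close> orbits lies exactly two ranks below the top.
  The other obstacle is that a merge determines its set \<open>B\<close> only up to translation by
  \<open>G\<close>, so two merges may use different representatives of a common orbit. A translation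
  makes them share one part, but in further common orbits they may still disagree. If all these
  orbits are absorbed in \<open>y\<close>, then two common orbits leave at most \<open>2 d\<close>
  orbits, few enough to absorb; with one common orbit there are \<open>2 d + 1\<close>, too many to
  absorb, but their representatives can be merged.\<close>

locale ranked_poset = bounded_poset L for L (structure) +
  fixes rk :: "'a \<Rightarrow> nat"
  assumes finite_carrier: "finite (carrier L)"
    and step: "\<lbrakk>x \<in> carrier L; y \<in> carrier L; x \<sqsubset> y\<rbrakk> \<Longrightarrow>
      \<exists>u\<in>carrier L. x \<sqsubset> u \<and> u \<sqsubseteq> y \<and> rk u = Suc (rk x)"
begin

text \<open>Strict monotonicity need not be assumed: iterating \<open>step\<close> climbs from
  \<open>x\<close> to \<open>y\<close>, and each round drops at least \<open>u\<close> from the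
  finite set of elements in \<open>(x, y]\<close>.\<close>

lemma rk_less:
  assumes "x \<in> carrier L" "y \<in> carrier L" "x \<sqsubset> y"
  shows "rk x < rk y"
  using assms
proof (induction "card {z \<in> carrier L. x \<sqsubset> z \<and> z \<sqsubseteq> y}" arbitrary: x rule: less_induct)
  case less
  obtain u where u: "u \<in> carrier L" "x \<sqsubset> u" "u \<sqsubseteq> y" "rk u = Suc (rk x)"
    using step less.prems by blast
  show ?case
  proof (cases "u = y")
    case False
    then have uy: "u \<sqsubset> y"
      using u by (simp add: lless_eq)
    have "{z \<in> carrier L. u \<sqsubset> z \<and> z \<sqsubseteq> y} \<subseteq> {z \<in> carrier L. x \<sqsubset> z \<and> z \<sqsubseteq> y}"
      using u less.prems lless_trans by blast
    moreover have "u \<notin> {z \<in> carrier L. u \<sqsubset> z \<and> z \<sqsubseteq> y}"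
      by (simp add: lless_eq)
    ultimately have "{z \<in> carrier L. u \<sqsubset> z \<and> z \<sqsubseteq> y} \<subset> {z \<in> carrier L. x \<sqsubset> z \<and> z \<sqsubseteq> y}"
      using u by blast
    then have "card {z \<in> carrier L. u \<sqsubset> z \<and> z \<sqsubseteq> y} < card {z \<in> carrier L. x \<sqsubset> z \<and> z \<sqsubseteq> y}"
      by (intro psubset_card_mono) (auto simp: finite_carrier)
    then show ?thesis
      using less.hyps[of u] u uy less.prems by simp
  qed (use u in simp)
qed

lemma rk_mono: "\<lbrakk>x \<in> carrier L; y \<in> carrier L; x \<sqsubseteq> y\<rbrakk> \<Longrightarrow> rk x \<le> rk y"
  using rk_less[of x y] by (cases "x = y") (auto simp: lless_eq)

text \<open>A step from \<open>x\<close> towards a cover \<open>y\<close> can only end in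
  \<open>y\<close>; conversely, a rank difference of one leaves no value for an element in
  between.\<close>

lemma covers_iff_rk:
  assumes "x \<in> carrier L" "y \<in> carrier L" "x \<sqsubseteq> y"
  shows "covers L y x \<longleftrightarrow> rk y = Suc (rk x)"
proof
  assume cov: "covers L y x"
  then obtain u where u: "u \<in> carrier L" "x \<sqsubset> u" "u \<sqsubseteq> y" "rk u = Suc (rk x)"
    using step unfolding covers_def by blast
  then have "u = y"
    using cov by (auto simp: covers_def lless_eq)
  then show "rk y = Suc (rk x)"
    using u by simp
next
  assume rk: "rk y = Suc (rk x)"
  then have "x \<sqsubset> y"
    using assms by (auto simp: lless_eq)
  moreover have "\<not> (x \<sqsubset> z \<and> z \<sqsubset> y)" if "z \<in> carrier L" for z
    using that rk_less[of x z] rk_less[of z y] rk assms by auto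
  ultimately show "covers L y x"
    using assms by (auto simp: covers_def)
qed

lemma bounded_poset_interval:
  assumes "a \<in> carrier L" "b \<in> carrier L" "a \<sqsubseteq> b"
  shows "bounded_poset (poset_interval L a b)"
proof -
  have "weak_partial_order (poset_interval L a b)"
    unfolding poset_interval_def
    by (rule weak_partial_order_subset) (auto simp: at_least_at_most_closed weak_partial_order_axioms)
  moreover have "least (poset_interval L a b) a (carrier (poset_interval L a b))"
    using assms by (auto simp: least_def Lower_def poset_interval_def at_least_at_most_def)
  moreover have "greatest (poset_interval L a b) b (carrier (poset_interval L a b))"
    using assms by (auto simp: greatest_def Upper_def poset_interval_def at_least_at_most_def)
  moreover have "eq (poset_interval L a b) = (=)"
    by (simp add: poset_interval_def eq_is_equal)
  ultimately show ?thesis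
    by (auto simp: bounded_poset_def partial_order_def partial_order_axioms_def
      weak_partial_order_bottom_def weak_partial_order_bottom_axioms_def
      weak_partial_order_top_def weak_partial_order_top_axioms_def)
qed

text \<open>The condition \<open>step\<close> already asks for \<open>u\<close> below
  \<open>y\<close>, so it survives in every interval. The function \<open>rk\<close> is not shifted
  to start at 0, since only differences of ranks enter the formulas.\<close>

lemma ranked_poset_interval:
  assumes "a \<in> carrier L" "b \<in> carrier L" "a \<sqsubseteq> b"
  shows "ranked_poset (poset_interval L a b) rk"
proof (intro ranked_poset.intro ranked_poset_axioms.intro)
  show "bounded_poset (poset_interval L a b)"
    using assms by (rule bounded_poset_interval)
  show "finite (carrier (poset_interval L a b))"
    using finite_subset[OF at_least_at_most_closed finite_carrier] by (simp add: poset_interval_def)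
next
  fix x y
  assume *: "x \<in> carrier (poset_interval L a b)" "y \<in> carrier (poset_interval L a b)"
    "lless (poset_interval L a b) x y"
  then have xy: "x \<in> carrier L" "y \<in> carrier L" "x \<sqsubset> y" "a \<sqsubseteq> x" "y \<sqsubseteq> b"
    by (auto simp: poset_interval_def at_least_at_most_def lless_def)
  then obtain u where u: "u \<in> carrier L" "x \<sqsubset> u" "u \<sqsubseteq> y" "rk u = Suc (rk x)"
    using step by blast
  have "a \<sqsubseteq> u" "u \<sqsubseteq> b"
    using u xy assms le_trans[of a x u] le_trans[of u y b] by (auto simp: lless_eq)
  then show "\<exists>u\<in>carrier (poset_interval L a b). lless (poset_interval L a b) x u \<and>
      le (poset_interval L a b) u y \<and> rk u = Suc (rk x)"
    using u by (intro bexI[of _ u]) (auto simp: poset_interval_def at_least_at_most_def lless_def)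
qed

lemma bottom_interval:
  assumes "a \<in> carrier L" "b \<in> carrier L" "a \<sqsubseteq> b"
  shows "bottom (poset_interval L a b) = a"
proof -
  interpret I: bounded_poset "poset_interval L a b"
    using assms by (rule bounded_poset_interval)
  have "least (poset_interval L a b) a (carrier (poset_interval L a b))"
    using assms by (auto simp: least_def Lower_def poset_interval_def at_least_at_most_def)
  then show ?thesis
    using I.bottom_least I.least_unique by blast
qed

lemma top_interval:
  assumes "a \<in> carrier L" "b \<in> carrier L" "a \<sqsubseteq> b"
  shows "top (poset_interval L a b) = b"
proof -
  interpret I: bounded_poset "poset_interval L a b"
    using assms by (rule bounded_poset_interval)
  have "greatest (poset_interval L a b) b (carrier (poset_interval L a b))"
    using assms by (auto simp: greatest_def Upper_def poset_interval_def at_least_at_most_def)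
  then show ?thesis
    using I.top_greatest I.greatest_unique by blast
qed

lemma maximal_chain_insert:
  assumes C: "maximal_chain L C" and u: "u \<in> carrier L"
    and comparable: "\<And>c. c \<in> C \<Longrightarrow> c \<sqsubseteq> u \<or> u \<sqsubseteq> c"
  shows "u \<in> C"
proof (rule ccontr)
  assume "u \<notin> C"
  moreover have "pred_on.chain (carrier L) (\<sqsubset>) (insert u C)"
    using pred_on.maxchain_imp_chain[OF C] u comparable unfolding pred_on.chain_def lless_eq by blast
  ultimately show False
    using C unfolding pred_on.maxchain_def by blast
qed

text \<open>On a maximal chain \<open>rk\<close> is injective and skips no value between the ranks
  of bottom and top: at a gap, \<open>step\<close> would provide an element that extends the
  chain.\<close>

lemma card_maximal_chain:
  assumes C: "maximal_chain L C"
  shows "card C = Suc (rk \<top> - rk \<bottom>)"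
proof -
  have sub: "C \<subseteq> carrier L" and tot: "\<And>x y. x \<in> C \<Longrightarrow> y \<in> C \<Longrightarrow> x \<sqsubseteq> y \<or> y \<sqsubseteq> x"
    using pred_on.maxchain_imp_chain[OF C] unfolding pred_on.chain_def lless_eq by blast+
  have bot: "\<bottom> \<in> C"
    by (rule maximal_chain_insert[OF C]) (use sub in auto)
  have top: "\<top> \<in> C"
    by (rule maximal_chain_insert[OF C]) (use sub in auto)
  have less_iff: "rk x < rk y \<longleftrightarrow> x \<sqsubset> y" if "x \<in> C" "y \<in> C" for x y
  proof -
    have "x \<in> carrier L" "y \<in> carrier L"
      using that sub by auto
    then show ?thesis
      using tot[OF that] rk_less[of x y] rk_less[of y x] unfolding lless_eq by (metis not_less_iff_gr_or_eq)
  qed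
  have "inj_on rk C"
  proof (rule inj_onI)
    fix x y assume "x \<in> C" "y \<in> C" "rk x = rk y"
    then show "x = y"
      using less_iff[of x y] less_iff[of y x] tot[of x y] by (auto simp: lless_eq)
  qed
  moreover have "rk ` C = {rk \<bottom>..rk \<top>}"
  proof
    show "rk ` C \<subseteq> {rk \<bottom>..rk \<top>}"
      using sub by (auto intro!: rk_mono bottom_lower top_higher)
    have "k \<in> rk ` C" if "rk \<bottom> \<le> k" "k \<le> rk \<top>" for k
      using that
    proof (induction k rule: dec_induct)
      case (step k)
      then obtain c where c: "c \<in> C" "rk c = k"
        by auto
      \<comment> \<open>The successor of \<open>c\<close> in the chain. The element \<open>u\<close>
        that \<open>step\<close> puts between \<open>c\<close> and \<open>y\<close> is then
        comparable with the whole chain.\<close>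
      define y where "y = arg_min_on rk {y \<in> C. k < rk y}"
      have fin: "finite {y \<in> C. k < rk y}"
        using finite_subset[OF sub finite_carrier] by simp
      have ne: "{y \<in> C. k < rk y} \<noteq> {}"
        using step top by auto
      have y: "y \<in> C" "k < rk y"
        using arg_min_if_finite(1)[OF fin ne, of rk] by (auto simp: y_def)
      have y_min: "rk y \<le> rk x" if "x \<in> C" "k < rk x" for x
        using arg_min_if_finite(2)[OF fin ne, of rk] that by (force simp: y_def not_less)
      obtain u where u: "u \<in> carrier L" "c \<sqsubset> u" "u \<sqsubseteq> y" "rk u = Suc k"
        using ranked_poset.step[OF ranked_poset_axioms, of c y] c y less_iff sub by blast
      have "x \<sqsubseteq> u \<or> u \<sqsubseteq> x" if x: "x \<in> C" for x
      proof (cases "k < rk x")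
        case True
        then have "\<not> x \<sqsubset> y"
          using y_min[OF x] less_iff[OF x y(1)] by simp
        then have "y \<sqsubseteq> x"
          using tot[OF x y(1)] by (auto simp: lless_eq)
        then show ?thesis
          using le_trans[of u y x] u x y sub by auto
      next
        case False
        then have "\<not> c \<sqsubset> x"
          using less_iff[OF c(1) x] c by simp
        then have "x \<sqsubseteq> c"
          using tot[OF x c(1)] by (auto simp: lless_eq)
        then show ?thesis
          using le_trans[of x c u] u x c sub by (auto simp: lless_eq)
      qed
      then have "u \<in> C"
        using maximal_chain_insert[OF C u(1)] by blast
      then show ?case
        using u by force
    qed (use bot in auto)
    then show "{rk \<bottom>..rk \<top>} \<subseteq> rk ` C"
      by auto
  qed
  ultimately have "card C = card {rk \<bottom>..rk \<top>}"
    using card_image by metis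
  also have "\<dots> = Suc (rk \<top> - rk \<bottom>)"
    using rk_mono[of \<bottom> \<top>] by (simp add: Suc_diff_le)
  finally show ?thesis .
qed

lemma pure: "pure_poset L"
  unfolding pure_poset_def
  using bounded_poset_axioms finite_carrier card_maximal_chain by auto

lemma poset_length_eq: "poset_length L = rk \<top> - rk \<bottom>"
  unfolding poset_length_def
proof (rule the_equality)
  show "\<forall>C. maximal_chain L C \<longrightarrow> card C - 1 = rk \<top> - rk \<bottom>"
    using card_maximal_chain by auto
next
  fix l assume l: "\<forall>C. maximal_chain L C \<longrightarrow> card C - 1 = l"
  \<comment> \<open>Without a maximal chain every \<open>l\<close> would satisfy the description;
    Hausdorff's principle supplies one.\<close>
  obtain C where "maximal_chain L C"
    using pred_on.Hausdorff by blast
  then show "l = rk \<top> - rk \<bottom>"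
    using l card_maximal_chain by auto
qed

lemma poset_rank_eq:
  assumes "x \<in> carrier L"
  shows "poset_rank L x = rk x - rk \<bottom>"
proof -
  interpret I: ranked_poset "poset_interval L \<bottom> x" rk
    using assms by (intro ranked_poset_interval) auto
  show ?thesis
    using I.poset_length_eq assms by (simp add: poset_rank_def bottom_interval top_interval)
qed

text \<open>The bound \<open>y\<close> stands for the upper end of an arbitrary interval: a
  \<open>z\<close> below it belongs to the interval, and by its rank it covers \<open>u\<close> and
  \<open>v\<close> there.\<close>

lemma totally_semimodularI:
  assumes join: "\<And>w u v y. \<lbrakk>w \<in> carrier L; u \<in> carrier L; v \<in> carrier L; y \<in> carrier L;
      w \<sqsubset> u; w \<sqsubset> v; u \<noteq> v; u \<sqsubseteq> y; v \<sqsubseteq> y; rk u = Suc (rk w); rk v = Suc (rk w)\<rbrakk> \<Longrightarrow>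
      \<exists>z\<in>carrier L. u \<sqsubseteq> z \<and> v \<sqsubseteq> z \<and> z \<sqsubseteq> y \<and> rk z = Suc (Suc (rk w))"
  shows "totally_semimodular L"
  unfolding totally_semimodular_def
proof (intro conjI ballI impI)
  show "bounded_poset L"
    by (rule bounded_poset_axioms)
next
  fix a b assume ab: "a \<in> carrier L" "b \<in> carrier L" "a \<sqsubseteq> b"
  interpret I: ranked_poset "poset_interval L a b" rk
    using ab by (rule ranked_poset_interval)
  have carr: "carrier (poset_interval L a b) = {x \<in> carrier L. a \<sqsubseteq> x \<and> x \<sqsubseteq> b}"
    and le: "le (poset_interval L a b) = (\<sqsubseteq>)"
    and less: "lless (poset_interval L a b) = (\<sqsubset>)"
    by (auto simp: poset_interval_def at_least_at_most_def lless_def fun_eq_iff)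
  show "semimodular (poset_interval L a b)"
    unfolding semimodular_def
  proof (intro conjI allI impI; (elim conjE)?)
    show "bounded_poset (poset_interval L a b)"
      by (rule I.bounded_poset_axioms)
  next
    fix u v w
    assume "u \<noteq> v" and uw: "covers (poset_interval L a b) u w"
      and vw: "covers (poset_interval L a b) v w"
    have uvw: "u \<in> carrier (poset_interval L a b)" "v \<in> carrier (poset_interval L a b)"
      "w \<in> carrier (poset_interval L a b)" "w \<sqsubset> u" "w \<sqsubset> v"
      using uw vw less by (auto simp: covers_def)
    have "rk u = Suc (rk w)" "rk v = Suc (rk w)"
      using uw vw uvw I.covers_iff_rk le by (auto simp: lless_eq)
    then obtain z where z: "z \<in> carrier L" "u \<sqsubseteq> z" "v \<sqsubseteq> z" "z \<sqsubseteq> b" "rk z = Suc (Suc (rk w))"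
      using join[of w u v b] uvw \<open>u \<noteq> v\<close> ab carr by auto
    then have "z \<in> carrier (poset_interval L a b)"
      using le_trans[of a u z] uvw ab carr by auto
    then have "covers (poset_interval L a b) z u" "covers (poset_interval L a b) z v"
      using I.covers_iff_rk[of u z] I.covers_iff_rk[of v z] uvw z le
        \<open>rk u = Suc (rk w)\<close> \<open>rk v = Suc (rk w)\<close> by auto
    then show "\<exists>z. covers (poset_interval L a b) z u \<and> covers (poset_interval L a b) z v"
      by blast
  qed
qed

end

subsection \<open>Free families of parts\<close>

locale dowling = group G for G (structure) +
  fixes n d :: nat
  assumes finite_G: "finite (carrier G)" and n_pos: "n \<ge> 1" and d_ge_2: "d \<ge> 2"
begin

abbreviation X where "X \<equiv> dowling_ground G n"
abbreviation c where "c \<equiv> order G"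

section \<open>The action on subsets of the ground set\<close>

definition act where "act g K = dowling_act G g ` K"

lemma c_pos: "c > 0"
  using finite_G one_closed by (auto simp: order_def card_gt_0_iff)

lemma finite_X: "finite X"
  by (simp add: dowling_ground_def finite_G)

lemma card_X: "card X = c * n"
  by (simp add: dowling_ground_def card_cartesian_product order_def)

lemma act_subset: "\<lbrakk>g \<in> carrier G; K \<subseteq> X\<rbrakk> \<Longrightarrow> act g K \<subseteq> X"
  by (auto simp: act_def dowling_act_def dowling_ground_def)

lemma act_one: "K \<subseteq> X \<Longrightarrow> act \<one> K = K"
  by (force simp: act_def dowling_act_def dowling_ground_def image_iff)

lemma act_act:
  assumes "g \<in> carrier G" "h \<in> carrier G" "K \<subseteq> X"
  shows "act g (act h K) = act (g \<otimes> h) K"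
proof -
  have "dowling_act G g (dowling_act G h x) = dowling_act G (g \<otimes> h) x" if "x \<in> K" for x
    using that assms by (auto simp: dowling_act_def dowling_ground_def m_assoc split: prod.splits)
  then show ?thesis
    by (auto simp: act_def image_image intro!: image_cong)
qed

lemma act_inv_act: "\<lbrakk>g \<in> carrier G; K \<subseteq> X\<rbrakk> \<Longrightarrow> act (inv g) (act g K) = K"
  by (simp add: act_act act_one)

lemma act_act_inv: "\<lbrakk>g \<in> carrier G; K \<subseteq> X\<rbrakk> \<Longrightarrow> act g (act (inv g) K) = K"
  by (simp add: act_act act_one)

lemma act_eqD:
  assumes "act g K = act h K'" "g \<in> carrier G" "h \<in> carrier G" "K \<subseteq> X" "K' \<subseteq> X"
  shows "K' = act (inv h \<otimes> g) K"
  using assms act_inv_act[of h K'] by (simp add: act_act flip: assms(1))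

lemma act_mono: "K \<subseteq> K' \<Longrightarrow> act g K \<subseteq> act g K'"
  by (auto simp: act_def)

lemma act_Union: "act g (\<Union>B) = \<Union>(act g ` B)"
  by (auto simp: act_def)

lemma act_Int_empty_iff:
  assumes "g \<in> carrier G" "K \<subseteq> X" "K' \<subseteq> X"
  shows "act g K \<inter> act g K' = {} \<longleftrightarrow> K \<inter> K' = {}"
proof
  show "K \<inter> K' = {}" if "act g K \<inter> act g K' = {}"
    using that by (auto simp: act_def)
  have "K \<inter> K' \<noteq> {}" if "act g K \<inter> act g K' \<noteq> {}"
  proof -
    have "act (inv g) (act g K) \<inter> act (inv g) (act g K') \<noteq> {}"
      using that by (auto simp: act_def)
    then show ?thesis
      using assms by (simp add: act_inv_act)
  qed
  then show "act g K \<inter> act g K' = {}" if "K \<inter> K' = {}"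
    using that by blast
qed

lemma card_act:
  assumes "g \<in> carrier G" "K \<subseteq> X"
  shows "card (act g K) = card K"
proof -
  have fin: "finite K"
    using assms finite_X finite_subset by blast
  then have "card (act g K) \<le> card K"
    by (simp add: act_def card_image_le)
  moreover have "card (act (inv g) (act g K)) \<le> card (act g K)"
    using fin by (simp add: act_def card_image_le)
  ultimately show ?thesis
    using assms by (simp add: act_inv_act)
qed

text \<open>The conditions on a Dowling partition with the component \<open>J\<close> left out.
  Every \<open>G\<close>-stable subfamily satisfies them again, so one predicate serves both for the
  elements of the poset and for the families that are absorbed.\<close>

definition free_parts where
  "free_parts \<pi> \<longleftrightarrow> disjoint \<pi> \<and> {} \<notin> \<pi> \<and> \<Union>\<pi> \<subseteq> X \<and>
     (\<forall>g\<in>carrier G. \<forall>K\<in>\<pi>. act g K \<in> \<pi> \<and> (g \<noteq> \<one> \<longrightarrow> act g K \<noteq> K))"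

lemma free_partsD:
  assumes "free_parts \<pi>"
  shows "\<And>K K'. \<lbrakk>K \<in> \<pi>; K' \<in> \<pi>; K \<inter> K' \<noteq> {}\<rbrakk> \<Longrightarrow> K = K'"
    and "\<And>K. K \<in> \<pi> \<Longrightarrow> K \<noteq> {}"
    and "\<And>K. K \<in> \<pi> \<Longrightarrow> K \<subseteq> X"
    and "\<And>g K. \<lbrakk>K \<in> \<pi>; g \<in> carrier G\<rbrakk> \<Longrightarrow> act g K \<in> \<pi>"
    and "\<And>g K. \<lbrakk>K \<in> \<pi>; g \<in> carrier G; act g K = K\<rbrakk> \<Longrightarrow> g = \<one>"
    and "finite \<pi>"
proof -
  have "\<pi> \<subseteq> Pow X"
    using assms by (auto simp: free_parts_def)
  then show "finite \<pi>"
    using finite_X finite_subset by blast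
qed (use assms in \<open>auto simp: free_parts_def disjoint_def\<close>)

lemma free_parts_subset:
  assumes "free_parts \<pi>" "A \<subseteq> \<pi>" "\<And>g K. \<lbrakk>g \<in> carrier G; K \<in> A\<rbrakk> \<Longrightarrow> act g K \<in> A"
  shows "free_parts A"
proof -
  have "disjoint A"
    using pairwise_subset assms unfolding free_parts_def by metis
  moreover have "\<Union>A \<subseteq> X"
    using Union_mono[OF assms(2)] assms(1) unfolding free_parts_def by (metis order_trans)
  moreover have "{} \<notin> A"
    using assms by (auto simp: free_parts_def)
  moreover have "act g K \<in> A \<and> (g \<noteq> \<one> \<longrightarrow> act g K \<noteq> K)" if "g \<in> carrier G" "K \<in> A" for g K
    using that assms by (auto simp: free_parts_def)
  ultimately show ?thesis
    by (simp add: free_parts_def)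
qed

lemma free_parts_Diff:
  assumes "free_parts \<pi>" "A \<subseteq> \<pi>" "free_parts A"
  shows "free_parts (\<pi> - A)"
proof (rule free_parts_subset[OF assms(1)])
  fix g K assume *: "g \<in> carrier G" "K \<in> \<pi> - A"
  have "act g K \<notin> A"
    using free_partsD(4)[OF assms(3), of "act g K" "inv g"] * free_partsD(3)[OF assms(1), of K]
    by (auto simp: act_inv_act)
  then show "act g K \<in> \<pi> - A"
    using * free_partsD(4)[OF assms(1)] by blast
qed blast

lemma free_parts_Un:
  assumes "free_parts \<pi>" "A \<subseteq> \<pi>" "free_parts A" "A' \<subseteq> \<pi>" "free_parts A'"
  shows "free_parts (A \<union> A')"
  using assms by (intro free_parts_subset[OF assms(1)]) (auto dest: free_partsD(4))

lemma free_parts_Int: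
  assumes "free_parts A" "free_parts A'"
  shows "free_parts (A \<inter> A')"
  using assms by (intro free_parts_subset[OF assms(1)]) (auto dest: free_partsD(4))

lemma Union_Int_empty:
  assumes "free_parts \<pi>" "S \<subseteq> \<pi>" "T \<subseteq> \<pi>" "S \<inter> T = {}"
  shows "\<Union>S \<inter> \<Union>T = {}"
  using assms free_partsD(1)[OF assms(1)] by blast

lemma card_Union_parts:
  assumes "free_parts \<pi>" "S \<subseteq> \<pi>"
  shows "card (\<Union>S) = (\<Sum>K\<in>S. card K)"
proof (rule card_Union_disjoint)
  show "disjoint S"
    using pairwise_subset assms unfolding free_parts_def by metis
  show "finite K" if "K \<in> S" for K
    using that assms free_partsD(3) finite_X finite_subset by (metis subsetD)
qed

section \<open>Orbits of parts and counting in units of the group order\<close>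

definition orbit where "orbit K = (\<lambda>g. act g K) ` carrier G"

lemma orbit_self: "K \<subseteq> X \<Longrightarrow> K \<in> orbit K"
  unfolding orbit_def by (rule image_eqI[of _ _ \<one>]) (auto simp: act_one)

lemma act_mem_orbit: "\<lbrakk>g \<in> carrier G; K \<subseteq> X; M \<in> orbit K\<rbrakk> \<Longrightarrow> act g M \<in> orbit K"
  by (auto simp: orbit_def act_act)

lemma orbit_subset: "\<lbrakk>free_parts \<pi>; K \<in> \<pi>\<rbrakk> \<Longrightarrow> orbit K \<subseteq> \<pi>"
  by (auto simp: orbit_def dest: free_partsD(4))

lemma free_parts_orbit: "\<lbrakk>free_parts \<pi>; K \<in> \<pi>\<rbrakk> \<Longrightarrow> free_parts (orbit K)"
  using free_partsD(3) by (intro free_parts_subset[OF _ orbit_subset]) (auto intro: act_mem_orbit)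

lemma act_eq_free:
  assumes "free_parts \<pi>" "K \<in> \<pi>" "g \<in> carrier G" "h \<in> carrier G" "act g K = act h K"
  shows "g = h"
proof -
  have "K \<subseteq> X"
    using assms free_partsD(3) by blast
  then have "act (inv h \<otimes> g) K = K"
    using act_eqD[of g K h K] assms by simp
  then have "inv h \<otimes> g = \<one>"
    using free_partsD(5)[OF assms(1,2), of "inv h \<otimes> g"] assms by auto
  then show ?thesis
    using assms by (metis inv_closed inv_equality inv_inv)
qed

lemma card_orbit: "\<lbrakk>free_parts \<pi>; K \<in> \<pi>\<rbrakk> \<Longrightarrow> card (orbit K) = c"
  unfolding orbit_def order_def by (rule card_image) (auto intro!: inj_onI dest: act_eq_free)

text \<open>Orbits are split off one at a time: each has \<open>c\<close> members, on which
  \<open>f\<close> is constant. The constant 1 gives the number of parts; the function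
  \<open>card K div d\<close> is needed as well.\<close>

lemma dvd_sum_free_parts:
  assumes "free_parts A"
    and "\<And>g K. \<lbrakk>g \<in> carrier G; K \<in> A\<rbrakk> \<Longrightarrow> f (act g K) = (f K :: nat)"
  shows "c dvd (\<Sum>K\<in>A. f K)"
  using assms
proof (induction "card A" arbitrary: A rule: less_induct)
  case less
  show ?case
  proof (cases "A = {}")
    case False
    then obtain K where K: "K \<in> A"
      by blast
    note fA = less.prems(1)
    have fin: "finite A" and sub: "orbit K \<subseteq> A" and self: "K \<in> orbit K"
      using free_partsD(3,6)[OF fA] orbit_subset[OF fA K] orbit_self K by auto
    have "c dvd (\<Sum>K\<in>A - orbit K. f K)"
    proof (rule less.hyps)
      show "card (A - orbit K) < card A"
        using fin K self by (intro psubset_card_mono) auto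
      show "free_parts (A - orbit K)"
        by (rule free_parts_Diff[OF fA sub free_parts_orbit[OF fA K]])
    qed (use less.prems in auto)
    moreover have "f M = f K" if "M \<in> orbit K" for M
      using that less.prems(2) K by (auto simp: orbit_def)
    then have "(\<Sum>M\<in>orbit K. f M) = c * f K"
      using card_orbit[OF fA K] by simp
    moreover have "(\<Sum>K\<in>A. f K) = (\<Sum>K\<in>A - orbit K. f K) + (\<Sum>M\<in>orbit K. f M)"
      using sum.subset_diff[OF sub fin] by simp
    ultimately show ?thesis
      by simp
  qed simp
qed

lemma dvd_card_free_parts: "free_parts A \<Longrightarrow> c dvd card A"
  using dvd_sum_free_parts[of A "\<lambda>_. 1"] by simp

text \<open>Orbits are added one by one. As all cardinalities are multiples of \<open>c\<close>, the
  target is hit exactly.\<close>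

lemma free_parts_extend:
  assumes S: "free_parts S" and A: "free_parts A" "A \<subseteq> S" and card: "card A \<le> c * k" "c * k \<le> card S"
  obtains A' where "free_parts A'" "A \<subseteq> A'" "A' \<subseteq> S" "card A' = c * k"
proof -
  have "\<exists>A'. free_parts A' \<and> A \<subseteq> A' \<and> A' \<subseteq> S \<and> card A' = c * k"
    using A card
  proof (induction "card S - card A" arbitrary: A rule: less_induct)
    case less
    show ?case
    proof (cases "card A = c * k")
      case False
      then have "card A < card S"
        using less.prems by simp
      then obtain K where K: "K \<in> S" "K \<notin> A"
        using card_mono[of A S] free_partsD(6)[OF less.prems(1)] by (metis leD subsetI)
      have orb: "orbit K \<subseteq> S" "free_parts (orbit K)" "card (orbit K) = c"
        using orbit_subset free_parts_orbit card_orbit S K by blast+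
      have "orbit K \<inter> A = {}"
      proof -
        have "orbit K \<subseteq> S - A"
          using K free_parts_Diff[OF S less.prems(2,1)] by (intro orbit_subset) auto
        then show ?thesis
          by blast
      qed
      then have card_Un: "card (A \<union> orbit K) = card A + c"
        using orb free_partsD(6)[OF less.prems(1)] free_partsD(6)[OF orb(2)]
        by (subst card_Un_disjoint) auto
      obtain a where a: "card A = c * a"
        using dvd_card_free_parts[OF less.prems(1)] by auto
      then have "a < k"
        using less.prems False by (metis le_neq_implies_less mult_le_cancel1 c_pos)
      then have "card A + c \<le> c * k"
        using mult_le_mono2[of "Suc a" k c] a by simp
      then have "\<exists>A'. free_parts A' \<and> A \<union> orbit K \<subseteq> A' \<and> A' \<subseteq> S \<and> card A' = c * k"
        using less.prems orb card_Un c_pos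
        by (intro less.hyps free_parts_Un[OF S]) auto
      then show ?thesis
        by blast
    qed (use less.prems in blast)
  qed
  then show thesis
    using that by blast
qed

subsection \<open>Merging and absorbing parts\<close>

text \<open>In a free family, \<open>B\<close> contains at most one part of each orbit. This is what
  allows \<open>B\<close> and all its translates to be merged simultaneously and freely.\<close>

definition transversal where
  "transversal \<pi> B \<longleftrightarrow> B \<subseteq> \<pi> \<and> (\<forall>g\<in>carrier G. \<forall>K\<in>B. act g K \<in> B \<longrightarrow> g = \<one>)"

definition sat where "sat B = (\<Union>K\<in>B. orbit K)"

definition merge where "merge \<pi> B = (\<pi> - sat B) \<union> orbit (\<Union>B)"

lemma transversal_subset: "\<lbrakk>transversal \<pi> D; B \<subseteq> D\<rbrakk> \<Longrightarrow> transversal \<pi> B"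
  unfolding transversal_def by blast

lemma subset_sat: "\<lbrakk>free_parts \<pi>; B \<subseteq> \<pi>\<rbrakk> \<Longrightarrow> B \<subseteq> sat B"
  unfolding sat_def by (meson UN_I free_partsD(3) orbit_self subsetD subsetI)

lemma sat_subset: "\<lbrakk>free_parts \<pi>; B \<subseteq> \<pi>\<rbrakk> \<Longrightarrow> sat B \<subseteq> \<pi>"
  unfolding sat_def by (meson UN_least orbit_subset subsetD)

lemma free_parts_sat: "\<lbrakk>free_parts \<pi>; B \<subseteq> \<pi>\<rbrakk> \<Longrightarrow> free_parts (sat B)"
  by (rule free_parts_subset[OF _ sat_subset]) (auto simp: sat_def intro!: act_mem_orbit dest: free_partsD(3))

text \<open>If \<open>act g K = act h K'\<close> with \<open>K\<close> and \<open>K'\<close> in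
  \<open>B\<close>, then \<open>inv h \<otimes> g\<close> carries \<open>K\<close> into
  \<open>B\<close> and so is \<open>\<one>\<close>. Hence the pairs \<open>(g, K)\<close>
  parametrize the saturation injectively.\<close>

lemma card_sat:
  assumes "free_parts \<pi>" "transversal \<pi> B"
  shows "card (sat B) = c * card B"
proof -
  have "sat B = (\<lambda>(g, K). act g K) ` (carrier G \<times> B)"
    by (auto simp: sat_def orbit_def)
  moreover have "inj_on (\<lambda>(g, K). act g K) (carrier G \<times> B)"
  proof (clarsimp intro!: inj_onI)
    fix g K h K'
    assume *: "g \<in> carrier G" "K \<in> B" "h \<in> carrier G" "K' \<in> B" "act g K = act h K'"
    then have KX: "K \<subseteq> X" "K' \<subseteq> X"
      using assms free_partsD(3) unfolding transversal_def by blast+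
    then have K': "K' = act (inv h \<otimes> g) K"
      using act_eqD[of g K h K'] * by blast
    then have "inv h \<otimes> g = \<one>"
      using assms(2) * unfolding transversal_def by (metis inv_closed m_closed)
    then show "g = h \<and> K = K'"
      using K' KX act_one * by (metis inv_closed inv_equality inv_inv)
  qed
  ultimately show ?thesis
    by (simp add: card_image order_def card_cartesian_product)
qed

lemma orbit_Union: "orbit (\<Union>B) = (\<lambda>g. \<Union>(act g ` B)) ` carrier G"
  by (simp add: orbit_def act_Union)

lemma Union_orbit_Union: "\<Union>(orbit (\<Union>B)) = \<Union>(sat B)"
  by (fastforce simp: sat_def orbit_def act_Union)

lemma act_image_disjoint:
  assumes "free_parts \<pi>" "transversal \<pi> B" "g \<in> carrier G" "h \<in> carrier G" "g \<noteq> h"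
  shows "act g ` B \<inter> act h ` B = {}"
proof -
  have False if *: "K \<in> B" "K' \<in> B" "act g K = act h K'" for K K'
  proof -
    have KX: "K \<subseteq> X" "K' \<subseteq> X"
      using assms * free_partsD(3) unfolding transversal_def by blast+
    then have "K' = act (inv h \<otimes> g) K"
      using act_eqD[of g K h K'] assms * by blast
    then have "inv h \<otimes> g = \<one>"
      using assms * unfolding transversal_def by (metis inv_closed m_closed)
    then show False
      using assms by (metis inv_closed inv_equality inv_inv)
  qed
  then show ?thesis
    by auto
qed

lemma Union_subset_X: "\<lbrakk>free_parts \<pi>; B \<subseteq> \<pi>\<rbrakk> \<Longrightarrow> \<Union>B \<subseteq> X"
  using free_partsD(3) by blast

text \<open>Distinct translates of \<open>B\<close> are disjoint sets of parts, so distinct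
  translates of its union are disjoint sets. If \<open>g\<close> fixes the translate by
  \<open>h\<close>, then the translates by \<open>g \<otimes> h\<close> and \<open>h\<close> meet,
  and \<open>g = \<one>\<close>.\<close>

lemma free_parts_merge:
  assumes \<pi>: "free_parts \<pi>" and B: "transversal \<pi> B" "B \<noteq> {}"
  shows "free_parts (merge \<pi> B)"
proof -
  have BX: "\<Union>B \<subseteq> X" and sub: "B \<subseteq> \<pi>"
    using Union_subset_X[OF \<pi>] B unfolding transversal_def by blast+
  have im_sub: "act g ` B \<subseteq> sat B" if "g \<in> carrier G" for g
    using that by (auto simp: sat_def orbit_def)
  have sat: "sat B \<subseteq> \<pi>" "free_parts (sat B)"
    using sat_subset[OF \<pi> sub] free_parts_sat[OF \<pi> sub] by blast+
  have disj: "act g (\<Union>B) \<inter> act h (\<Union>B) = {}" if "g \<in> carrier G" "h \<in> carrier G" "g \<noteq> h" for g h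
    unfolding act_Union
    using that im_sub sat by (intro Union_Int_empty[OF \<pi>] act_image_disjoint[OF \<pi> B(1)]) blast+
  have disj': "K \<inter> act g (\<Union>B) = {}" if "g \<in> carrier G" "K \<in> \<pi> - sat B" for g K
    using Union_Int_empty[OF \<pi>, of "{K}" "act g ` B"] that im_sub[OF that(1)] sat(1)
    unfolding act_Union by auto
  have ne: "act g (\<Union>B) \<noteq> {}" for g
    using B(2) sub free_partsD(2)[OF \<pi>] by (fastforce simp: act_def)
  show ?thesis
    unfolding free_parts_def
  proof (intro conjI ballI)
    show "disjoint (merge \<pi> B)"
    proof (rule disjointI)
      fix M M' assume *: "M \<in> merge \<pi> B" "M' \<in> merge \<pi> B" "M \<noteq> M'"
      have "N \<in> \<pi> - sat B \<or> (\<exists>g\<in>carrier G. N = act g (\<Union>B))" if "N \<in> merge \<pi> B" for N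
        using that by (auto simp: merge_def orbit_def)
      from this[OF *(1)] this[OF *(2)] show "M \<inter> M' = {}"
      proof (elim disjE bexE)
        assume "M \<in> \<pi> - sat B" "M' \<in> \<pi> - sat B"
        then show ?thesis
          using free_partsD(1)[OF \<pi>, of M M'] *(3) by auto
      next
        fix g assume "M \<in> \<pi> - sat B" "g \<in> carrier G" "M' = act g (\<Union>B)"
        then show ?thesis
          using disj' by simp
      next
        fix g assume "M' \<in> \<pi> - sat B" "g \<in> carrier G" "M = act g (\<Union>B)"
        then show ?thesis
          using disj'[of g M'] by (simp add: Int_commute)
      next
        fix g h assume "g \<in> carrier G" "M = act g (\<Union>B)" "h \<in> carrier G" "M' = act h (\<Union>B)"
        then show ?thesis
          using disj[of g h] *(3) by auto
      qed
    qed
    show "{} \<notin> merge \<pi> B"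
      using ne free_partsD(2)[OF \<pi>] by (auto simp: merge_def orbit_def)
    show "\<Union>(merge \<pi> B) \<subseteq> X"
      unfolding merge_def orbit_def using free_partsD(3)[OF \<pi>] act_subset[OF _ BX]
      by (intro Sup_least) auto
  next
    fix g M assume g: "g \<in> carrier G" and M: "M \<in> merge \<pi> B"
    have "act g M \<in> merge \<pi> B \<and> (act g M = M \<longrightarrow> g = \<one>)"
    proof (cases "M \<in> \<pi> - sat B")
      case True
      then have "act g M \<in> \<pi> - sat B"
        using free_partsD(4)[OF free_parts_Diff[OF \<pi> sat]] g by blast
      then show ?thesis
        using True free_partsD(5)[OF \<pi>] g by (auto simp: merge_def)
    next
      case False
      then obtain h where h: "h \<in> carrier G" "M = act h (\<Union>B)"
        using M by (auto simp: merge_def orbit_def)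
      have gM: "act g M = act (g \<otimes> h) (\<Union>B)"
        using h g BX by (simp add: act_act)
      have "g \<otimes> h = h" if "act g M = M"
        using disj[of "g \<otimes> h" h] that gM h g ne by (metis Int_absorb m_closed)
      then have "act g M = M \<longrightarrow> g = \<one>"
        using g h by (metis r_cancel_one)
      moreover have "act g M \<in> merge \<pi> B"
        using gM g h by (auto simp: merge_def orbit_def)
      ultimately show ?thesis
        by blast
    qed
    then show "act g M \<in> merge \<pi> B" "g \<noteq> \<one> \<longrightarrow> act g M \<noteq> M"
      by blast+
  qed
qed

lemma Union_mem_merge: "\<lbrakk>free_parts \<pi>; B \<subseteq> \<pi>\<rbrakk> \<Longrightarrow> \<Union>B \<in> merge \<pi> B"
  using orbit_self[OF Union_subset_X] by (auto simp: merge_def)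

text \<open>The \<open>c * card B\<close> parts of the saturation give way to the \<open>c\<close>
  translates of the union of \<open>B\<close>; the additive form avoids truncated
  subtraction.\<close>

lemma card_merge:
  assumes \<pi>: "free_parts \<pi>" and B: "transversal \<pi> B" "B \<noteq> {}"
  shows "card (merge \<pi> B) + c * card B = card \<pi> + c"
proof -
  have sub: "B \<subseteq> \<pi>"
    using B by (simp add: transversal_def)
  have sat: "sat B \<subseteq> \<pi>"
    by (rule sat_subset[OF \<pi> sub])
  have fin: "finite \<pi>" "finite (orbit (\<Union>B))"
    using free_partsD(6)[OF \<pi>] finite_G by (auto simp: orbit_def)
  \<comment> \<open>A common member would be a nonempty set inside two disjoint unions.\<close>
  have "(\<pi> - sat B) \<inter> orbit (\<Union>B) = {}"
  proof -
    have "\<Union>(\<pi> - sat B) \<inter> \<Union>(sat B) = {}"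
      using sat by (intro Union_Int_empty[OF \<pi>]) auto
    then show ?thesis
      using free_partsD(2)[OF \<pi>] unfolding Union_orbit_Union[symmetric] by fastforce
  qed
  then have "card (merge \<pi> B) = card (\<pi> - sat B) + card (orbit (\<Union>B))"
    unfolding merge_def using fin by (simp add: card_Un_disjoint)
  moreover have "card (orbit (\<Union>B)) = c"
    using card_orbit[OF free_parts_merge[OF assms] Union_mem_merge[OF \<pi> sub]] .
  moreover have "card (\<pi> - sat B) + c * card B = card \<pi>"
    using card_sat[OF \<pi> B(1)] card_Diff_subset[OF finite_subset[OF sat fin(1)] sat] card_mono[OF fin(1) sat]
    by simp
  ultimately show ?thesis
    by simp
qed

text \<open>This freedom in the choice of \<open>B\<close> is used to make two merges that touch a
  common orbit share a part of it.\<close>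

lemma merge_act:
  assumes \<pi>: "free_parts \<pi>" and B: "B \<subseteq> \<pi>" and g: "g \<in> carrier G"
  shows "sat (act g ` B) = sat B" "merge \<pi> (act g ` B) = merge \<pi> B"
proof -
  have orb: "orbit (act g K) = orbit K" if "K \<subseteq> X" for K
  proof
    show "orbit (act g K) \<subseteq> orbit K"
      using that g by (auto simp: orbit_def act_act)
    have "act h K = act (h \<otimes> inv g) (act g K)" if "h \<in> carrier G" for h
      using that g \<open>K \<subseteq> X\<close> by (simp add: act_act m_assoc)
    then show "orbit K \<subseteq> orbit (act g K)"
      unfolding orbit_def using g by (intro image_subsetI) (metis image_eqI inv_closed m_closed)
  qed
  then show sat: "sat (act g ` B) = sat B"
    using free_partsD(3)[OF \<pi>] B by (auto simp: sat_def)
  show "merge \<pi> (act g ` B) = merge \<pi> B"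
    unfolding merge_def sat using orb[OF Union_subset_X[OF \<pi> B]] by (simp add: act_Union)
qed

lemma transversal_act:
  assumes \<pi>: "free_parts \<pi>" and B: "transversal \<pi> B" and g: "g \<in> carrier G"
  shows "transversal \<pi> (act g ` B)" "card (act g ` B) = card B"
proof -
  have sub: "B \<subseteq> \<pi>"
    using B by (simp add: transversal_def)
  have BX: "K \<subseteq> X" if "K \<in> B" for K
    using that sub free_partsD(3)[OF \<pi>] by blast
  show "card (act g ` B) = card B"
    by (rule card_image) (use act_inv_act g BX in \<open>metis inj_onI\<close>)
  have "h = \<one>" if *: "h \<in> carrier G" "K \<in> B" "K' \<in> B" "act h (act g K) = act g K'" for h K K'
  proof -
    have "act (h \<otimes> g) K = act g K'"
      using * g BX by (simp add: act_act)
    then have K': "K' = act (inv g \<otimes> (h \<otimes> g)) K"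
      using act_eqD[of "h \<otimes> g" K g K'] * g BX by simp
    then have "inv g \<otimes> (h \<otimes> g) = \<one>"
      using B * g unfolding transversal_def by (metis inv_closed m_closed)
    then have "h \<otimes> g = g"
      using g * by (metis inv_closed inv_equality inv_inv m_closed)
    then show ?thesis
      using g * by (metis r_cancel_one)
  qed
  then show "transversal \<pi> (act g ` B)"
    using sub free_partsD(4)[OF \<pi>] g unfolding transversal_def by (auto simp: image_iff)
qed

text \<open>
  The first component of an element of the Dowling lattice is the complement of the union of its
  parts, so the order can be expressed through the second components alone: every part of the
  larger element is a union of parts of the smaller one.
\<close>

definition below :: "('a \<times> nat) set set \<Rightarrow> ('a \<times> nat) set set \<Rightarrow> bool" where
  "below \<pi> \<rho> \<longleftrightarrow> (\<forall>M\<in>\<rho>. \<forall>x\<in>M. \<exists>K\<in>\<pi>. x \<in> K \<and> K \<subseteq> M)"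

lemma below_refl: "below \<pi> \<pi>"
  unfolding below_def by blast

lemma below_trans: "\<lbrakk>below \<pi> \<rho>; below \<rho> \<sigma>\<rbrakk> \<Longrightarrow> below \<pi> \<sigma>"
  unfolding below_def by (meson order_trans)

lemma below_empty: "below \<pi> {}"
  by (simp add: below_def)

lemma below_Union: "below \<pi> \<rho> \<Longrightarrow> \<Union>\<rho> \<subseteq> \<Union>\<pi>"
  unfolding below_def by blast

lemma below_Union_eq: "\<lbrakk>below \<pi> \<rho>; M \<in> \<rho>\<rbrakk> \<Longrightarrow> \<Union>{K \<in> \<pi>. K \<subseteq> M} = M"
  unfolding below_def by blast

lemma below_part_subset:
  assumes "free_parts \<pi>" "below \<pi> \<rho>" "M \<in> \<rho>" "K \<in> \<pi>" "K \<inter> M \<noteq> {}"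
  shows "K \<subseteq> M"
proof -
  obtain x where x: "x \<in> K" "x \<in> M"
    using assms by blast
  then obtain K' where "K' \<in> \<pi>" "x \<in> K'" "K' \<subseteq> M"
    using assms(2,3) unfolding below_def by meson
  moreover have "K = K'"
    using free_partsD(1)[OF assms(1,4), of K'] x calculation by blast
  ultimately show ?thesis
    by simp
qed

lemma below_part_cases:
  assumes "free_parts \<pi>" "below \<pi> \<rho>" "K \<in> \<pi>"
  shows "K \<inter> \<Union>\<rho> = {} \<or> (\<exists>M\<in>\<rho>. K \<subseteq> M)"
  using below_part_subset[OF assms(1,2) _ assms(3)] by blast

lemma below_antisym:
  assumes "free_parts \<pi>" "free_parts \<rho>" "below \<pi> \<rho>" "below \<rho> \<pi>"
  shows "\<pi> = \<rho>"
proof -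
  have "\<pi> \<subseteq> \<rho>" if *: "free_parts \<pi>" "free_parts \<rho>" "below \<pi> \<rho>" "below \<rho> \<pi>" for \<pi> \<rho>
  proof
    fix K assume K: "K \<in> \<pi>"
    then have "K \<subseteq> \<Union>\<rho>" "K \<noteq> {}"
      using below_Union[OF *(4)] free_partsD(2)[OF *(1)] by blast+
    then obtain M where M: "M \<in> \<rho>" "K \<subseteq> M"
      using below_part_cases[OF *(1,3) K] by blast
    then have "M \<subseteq> K"
      using below_part_subset[OF *(2,4) K M(1)] \<open>K \<noteq> {}\<close> by blast
    then show "K \<in> \<rho>"
      using M by auto
  qed
  then show ?thesis
    using assms by blast
qed

lemma below_merge:
  assumes \<pi>: "free_parts \<pi>" and B: "B \<subseteq> \<pi>"
  shows "below \<pi> (merge \<pi> B)"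
  unfolding below_def
proof (intro ballI)
  fix M x assume M: "M \<in> merge \<pi> B" "x \<in> M"
  show "\<exists>K\<in>\<pi>. x \<in> K \<and> K \<subseteq> M"
  proof (cases "M \<in> \<pi>")
    case False
    then obtain g where g: "g \<in> carrier G" "M = \<Union>(act g ` B)"
      using M by (auto simp: merge_def orbit_Union)
    then have "act g ` B \<subseteq> \<pi>"
      using B free_partsD(4)[OF \<pi>] by blast
    then show ?thesis
      using g M by blast
  qed (use M in blast)
qed

text \<open>It suffices that the members of \<open>B\<close> have a common fate in the larger
  family: all absorbed, or all inside one part. The translates inherit it: if the translate by
  \<open>g\<close> meets \<open>M\<close>, then \<open>B\<close> meets \<open>act (inv g) M\<close>,
  which is again a part.\<close>

lemma merge_below:
  assumes \<pi>: "free_parts \<pi>" and \<rho>: "free_parts \<rho>" and le: "below \<pi> \<rho>" and B: "B \<subseteq> \<pi>"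
    and cases: "\<Union>B \<inter> \<Union>\<rho> = {} \<or> (\<exists>M\<in>\<rho>. \<Union>B \<subseteq> M)"
  shows "below (merge \<pi> B) \<rho>"
  unfolding below_def
proof (intro ballI)
  fix M x assume M: "M \<in> \<rho>" and x: "x \<in> M"
  have BX: "\<Union>B \<subseteq> X" and MX: "M \<subseteq> X"
    using Union_subset_X[OF \<pi> B] free_partsD(3)[OF \<rho> M] by auto
  show "\<exists>N\<in>merge \<pi> B. x \<in> N \<and> N \<subseteq> M"
  proof -
    obtain K where K: "K \<in> \<pi>" "x \<in> K" "K \<subseteq> M"
      using below_Union_eq[OF le M] x by blast
    show ?thesis
    proof (cases "K \<in> sat B")
      case True
      then obtain g K0 where g: "g \<in> carrier G" "K0 \<in> B" "K = act g K0"
        by (auto simp: sat_def orbit_def)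
      have "x \<in> act g (\<Union>B)"
        using K g by (auto simp: act_def)
      then have "act g (\<Union>B) \<inter> act g (act (inv g) M) \<noteq> {}"
        using x MX g by (auto simp: act_act_inv)
      then have meet: "\<Union>B \<inter> act (inv g) M \<noteq> {}"
        using act_Int_empty_iff[of g "\<Union>B" "act (inv g) M"] g BX act_subset[OF _ MX] by auto
      have iM: "act (inv g) M \<in> \<rho>"
        using free_partsD(4)[OF \<rho> M] g by auto
      then have "\<Union>B \<subseteq> act (inv g) M"
        using cases meet free_partsD(1)[OF \<rho> _ iM] by blast
      then have "act g (\<Union>B) \<subseteq> M"
        using act_mono[of "\<Union>B" "act (inv g) M" g] act_act_inv[OF g(1) MX] by simp
      then show ?thesis
        using \<open>x \<in> act g (\<Union>B)\<close> g by (auto simp: merge_def orbit_def)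
    qed (use K in \<open>auto simp: merge_def\<close>)
  qed
qed

lemma below_Diff: "below \<pi> (\<pi> - A)"
  unfolding below_def by blast

lemma Diff_below:
  assumes "below \<pi> \<rho>" "\<Union>A \<inter> \<Union>\<rho> = {}"
  shows "below (\<pi> - A) \<rho>"
  unfolding below_def
proof (intro ballI)
  fix M x assume M: "M \<in> \<rho>" "x \<in> M"
  then obtain K where K: "K \<in> \<pi>" "x \<in> K" "K \<subseteq> M"
    using assms(1) unfolding below_def by meson
  moreover have "K \<notin> A"
    using assms(2) M K by auto
  ultimately show "\<exists>K\<in>\<pi> - A. x \<in> K \<and> K \<subseteq> M"
    by blast
qed

subsection \<open>Rank and elementary steps\<close>

definition mod1_parts where
  "mod1_parts A \<longleftrightarrow> free_parts A \<and> (\<forall>K\<in>A. card K mod d = 1)"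

text \<open>The condition on \<open>J\<close> expressed by the number of orbits of parts. All parts
  have size 1 modulo \<open>d\<close>, so modulo \<open>d\<close> that number is \<open>n\<close>
  minus the size of \<open>J\<close> in units of \<open>c\<close>; see
  \<open>cong_complement_iff\<close>. The empty family is the case \<open>J = X\<close>.\<close>

definition valid where
  "valid \<pi> \<longleftrightarrow> mod1_parts \<pi> \<and> (\<pi> = {} \<or> [card \<pi> div c = n] (mod d))"

text \<open>The first value is the ceiling of \<open>n / d\<close>; in the second, the division by
  \<open>d\<close> is exact for valid families.\<close>

definition rnk :: "('a \<times> nat) set set \<Rightarrow> nat" where
  "rnk \<pi> = (if \<pi> = {} then (n + d - 1) div d else (n - card \<pi> div c) div d)"

lemma valid_free: "valid \<pi> \<Longrightarrow> free_parts \<pi>"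
  by (simp add: valid_def mod1_parts_def)

lemma valid_mod1: "valid \<pi> \<Longrightarrow> mod1_parts \<pi>"
  by (simp add: valid_def)

lemma mod1_parts_subset: "\<lbrakk>mod1_parts \<pi>; A \<subseteq> \<pi>; free_parts A\<rbrakk> \<Longrightarrow> mod1_parts A"
  unfolding mod1_parts_def by blast

lemma free_parts_empty: "free_parts {}"
  by (simp add: free_parts_def)

lemma valid_empty: "valid {}"
  by (simp add: valid_def mod1_parts_def free_parts_empty)

lemma card_Union_mod1:
  assumes "mod1_parts \<pi>" "S \<subseteq> \<pi>"
  shows "card (\<Union>S) = card S + d * (\<Sum>K\<in>S. card K div d)"
proof -
  have "card K = 1 + d * (card K div d)" if "K \<in> S" for K
    using that assms mult_div_mod_eq[of d "card K"] unfolding mod1_parts_def by fastforce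
  then have "(\<Sum>K\<in>S. card K) = (\<Sum>K\<in>S. 1 + d * (card K div d))"
    by (rule sum.cong[OF refl])
  also have "\<dots> = card S + d * (\<Sum>K\<in>S. card K div d)"
    unfolding sum.distrib sum_distrib_left by simp
  finally show ?thesis
    using card_Union_parts[of \<pi> S] assms unfolding mod1_parts_def by simp
qed

text \<open>The excess of the size of the union over the number of parts is \<open>d\<close> times a
  sum of a \<open>G\<close>-invariant function. That this sum is itself a multiple of
  \<open>c\<close> has to come from the invariance, because \<open>c\<close> and \<open>d\<close>
  may have common factors.\<close>

lemma mod1_parts_card:
  assumes "mod1_parts A"
  obtains r s where "card A = c * r" "card (\<Union>A) = c * (r + d * s)"
proof -
  have A: "free_parts A"
    using assms by (simp add: mod1_parts_def)
  obtain r where r: "card A = c * r"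
    using dvd_card_free_parts[OF A] by blast
  have "c dvd (\<Sum>K\<in>A. card K div d)"
    using card_act free_partsD(3)[OF A] by (intro dvd_sum_free_parts[OF A]) simp
  then obtain s where s: "(\<Sum>K\<in>A. card K div d) = c * s"
    by blast
  have "card (\<Union>A) = c * (r + d * s)"
    using card_Union_mod1[OF assms subset_refl] r s by (simp add: algebra_simps)
  with r show thesis
    by (rule that)
qed

lemma mod1_parts_card_le:
  assumes "mod1_parts \<pi>" "card \<pi> = c * r"
  shows "r \<le> n"
proof -
  obtain r' s where *: "card \<pi> = c * r'" "card (\<Union>\<pi>) = c * (r' + d * s)"
    using mod1_parts_card[OF assms(1)] by blast
  have "card (\<Union>\<pi>) \<le> c * n"
    using card_mono[OF finite_X, of "\<Union>\<pi>"] card_X assms(1) by (simp add: mod1_parts_def free_parts_def)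
  then have "r' + d * s \<le> n"
    using * c_pos by simp
  moreover have "r' = r"
    using * assms(2) c_pos by simp
  ultimately show ?thesis
    by simp
qed

lemma card_free_parts_ge:
  assumes "free_parts A" "A \<noteq> {}"
  shows "c \<le> card A"
  using dvd_card_free_parts[OF assms(1)] free_partsD(6)[OF assms(1)] assms(2)
  by (simp add: card_gt_0_iff dvd_imp_le)

text \<open>The normal form for all rank arithmetic: with \<open>r\<close> orbits of parts and rank
  \<open>t\<close>, a step that does not lead to the top lowers \<open>r\<close> by \<open>d\<close>
  and raises \<open>t\<close> by one.\<close>

lemma valid_obtain:
  assumes "valid \<pi>" "\<pi> \<noteq> {}"
  obtains r t where "card \<pi> = c * r" "n = r + d * t" "r \<ge> 1" "rnk \<pi> = t"
proof -
  obtain r where r: "card \<pi> = c * r"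
    using dvd_card_free_parts[OF valid_free[OF assms(1)]] by blast
  have "r \<le> n"
    using mod1_parts_card_le[OF valid_mod1[OF assms(1)] r] .
  have "[n = r] (mod d)"
    using assms r c_pos by (simp add: valid_def cong_sym_eq)
  then have "d dvd n - r"
    using \<open>r \<le> n\<close> by (simp add: cong_altdef_nat)
  then obtain t where t: "n - r = d * t"
    by blast
  have "rnk \<pi> = t"
    using assms(2) r t c_pos d_ge_2 by (simp add: rnk_def)
  moreover have "r \<ge> 1"
    using card_free_parts_ge[OF valid_free[OF assms(1)] assms(2)] r c_pos by (cases r) auto
  moreover have "n = r + d * t"
    using t \<open>r \<le> n\<close> by simp
  ultimately show thesis
    using that r by blast
qed

lemma validI:
  assumes "mod1_parts \<pi>" "\<pi> \<noteq> {}" "card \<pi> = c * r" "n = r + d * t"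
  shows "valid \<pi>" "rnk \<pi> = t"
proof -
  have "[r = n] (mod d)" and t: "n - r = d * t"
    using assms(4) by (simp_all add: cong_def)
  then show "valid \<pi>"
    using assms(1-3) c_pos by (simp add: valid_def)
  show "rnk \<pi> = t"
    using assms(2,3) t c_pos d_ge_2 by (simp add: rnk_def)
qed

text \<open>The hypotheses say that \<open>Suc k\<close> is the ceiling of \<open>r / d\<close>, the
  rank distance to the top from an element with \<open>r\<close> orbits. The remainder
  \<open>r - d * k - 1\<close> lies between 0 and \<open>d - 1\<close>.\<close>

lemma rnk_empty:
  assumes "n = r + d * t" "d * k < r" "r \<le> d * Suc k"
  shows "rnk {} = t + Suc k"
proof -
  have "n + d - 1 = d * (t + Suc k) + (r - d * k - 1)"
    using assms by (simp add: algebra_simps)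
  moreover have "(r - d * k - 1) div d = 0" "d \<noteq> 0"
    using assms d_ge_2 by auto
  ultimately have "(n + d - 1) div d = t + Suc k"
    by (simp only: div_mult_self4 add_0_right not_False_eq_True)
  then show ?thesis
    by (simp add: rnk_def)
qed

text \<open>The number of orbits drops by \<open>d * k\<close>, and a union of
  \<open>d * k + 1\<close> parts has size 1 modulo \<open>d\<close> again. Elementary steps take
  \<open>k = 1\<close>, joins \<open>k = 2\<close>.\<close>

lemma valid_merge:
  assumes \<pi>: "valid \<pi>" and B: "transversal \<pi> B" "card B = Suc (d * k)"
  shows "valid (merge \<pi> B)" "rnk (merge \<pi> B) = rnk \<pi> + k"
proof -
  have sub: "B \<subseteq> \<pi>" and ne: "B \<noteq> {}" and \<pi>ne: "\<pi> \<noteq> {}"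
    using B by (auto simp: transversal_def)
  note free = valid_free[OF \<pi>]
  obtain r t where r: "card \<pi> = c * r" "n = r + d * t" "rnk \<pi> = t"
    using valid_obtain[OF \<pi> \<pi>ne] by metis
  have card: "card (merge \<pi> B) + c * card B = card \<pi> + c"
    by (rule card_merge[OF free B(1) ne])
  have "c * card B \<le> card \<pi>"
    using card_sat[OF free B(1)] card_mono[OF free_partsD(6)[OF free] sat_subset[OF free sub]] by simp
  then have le: "Suc (d * k) \<le> r"
    unfolding r(1) B(2) mult_le_cancel1 using c_pos by blast
  have card': "card (merge \<pi> B) = c * (r - d * k)"
  proof -
    have "card (merge \<pi> B) + c * (d * k) = c * (r - d * k) + c * (d * k)"
      using card le unfolding r(1) B(2) by (simp flip: distrib_left)
    then show ?thesis
      by simp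
  qed
  have fm: "free_parts (merge \<pi> B)"
    by (rule free_parts_merge[OF free B(1) ne])
  have "card M mod d = 1" if M: "M \<in> merge \<pi> B" for M
  proof (cases "M \<in> \<pi>")
    case True
    then show ?thesis
      using valid_mod1[OF \<pi>] by (simp add: mod1_parts_def)
  next
    case False
    then obtain g where g: "g \<in> carrier G" "M = act g (\<Union>B)"
      using M by (auto simp: merge_def orbit_def)
    then have "card M = card (\<Union>B)"
      using card_act Union_subset_X[OF free sub] by simp
    moreover have "card (\<Union>B) = 1 + d * (k + (\<Sum>K\<in>B. card K div d))"
      using card_Union_mod1[OF valid_mod1[OF \<pi>] sub] B by (simp add: distrib_left)
    ultimately have "card M mod d = 1 mod d"
      by (simp only: mod_mult_self2)
    then show ?thesis
      using d_ge_2 by simp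
  qed
  then have m: "mod1_parts (merge \<pi> B)"
    using fm by (simp add: mod1_parts_def)
  have ne': "merge \<pi> B \<noteq> {}"
    using Union_mem_merge[OF free sub] by blast
  have n: "n = (r - d * k) + d * (t + k)"
    using le r by (simp add: algebra_simps)
  show "valid (merge \<pi> B)" "rnk (merge \<pi> B) = rnk \<pi> + k"
    using validI[OF m ne' card' n] r(3) by auto
qed

text \<open>The absorption may exhaust the family. Then \<open>r = d * k\<close>, and the ceiling in
  the rank of the top agrees with the exact quotient.\<close>

lemma valid_Diff:
  assumes \<pi>: "valid \<pi>" "\<pi> \<noteq> {}" and A: "free_parts A" "A \<subseteq> \<pi>" "card A = c * (d * k)"
  shows "valid (\<pi> - A)" "rnk (\<pi> - A) = rnk \<pi> + k"
proof -
  note free = valid_free[OF \<pi>(1)]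
  obtain r t where r: "card \<pi> = c * r" "n = r + d * t" "rnk \<pi> = t" "r \<ge> 1"
    using valid_obtain[OF \<pi>] by metis
  have "card A \<le> card \<pi>"
    using card_mono[OF free_partsD(6)[OF free] A(2)] .
  then have le: "d * k \<le> r"
    unfolding r(1) A(3) mult_le_cancel1 using c_pos by blast
  have card: "card (\<pi> - A) = c * (r - d * k)"
    using card_Diff_subset[OF free_partsD(6)[OF A(1)] A(2)] A r by (simp add: diff_mult_distrib2)
  have n: "n = (r - d * k) + d * (t + k)"
    using le r by (simp add: algebra_simps)
  have m: "mod1_parts (\<pi> - A)"
    using mod1_parts_subset[OF valid_mod1[OF \<pi>(1)] Diff_subset free_parts_Diff[OF free A(2,1)]] .
  have "valid (\<pi> - A) \<and> rnk (\<pi> - A) = rnk \<pi> + k"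
  proof (cases "\<pi> - A = {}")
    case True
    then have "c * (r - d * k) = 0"
      using card by (metis card.empty)
    then have "r = d * k"
      using c_pos le by simp
    moreover then obtain k' where "k = Suc k'"
      using r by (cases k) auto
    ultimately have "rnk {} = t + k"
      using rnk_empty[OF r(2), of k'] d_ge_2 by simp
    then show ?thesis
      unfolding True using valid_empty r(3) by simp
  next
    case False
    then show ?thesis
      using validI[OF m False card n] r(3) by simp
  qed
  then show "valid (\<pi> - A)" "rnk (\<pi> - A) = rnk \<pi> + k"
    by auto
qed

section \<open>Parts absorbed in a larger element\<close>

definition gone where "gone \<pi> \<rho> = {K \<in> \<pi>. K \<inter> \<Union>\<rho> = {}}"

lemma gone_subset: "gone \<pi> \<rho> \<subseteq> \<pi>"
  by (auto simp: gone_def)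

lemma gone_empty: "gone \<pi> {} = \<pi>"
  by (simp add: gone_def)

lemma Union_gone: "A \<subseteq> gone \<pi> \<rho> \<Longrightarrow> \<Union>A \<inter> \<Union>\<rho> = {}"
  unfolding gone_def by blast

lemma free_parts_gone:
  assumes \<pi>: "free_parts \<pi>" and \<rho>: "free_parts \<rho>"
  shows "free_parts (gone \<pi> \<rho>)"
proof (rule free_parts_subset[OF \<pi> gone_subset])
  fix g K assume *: "g \<in> carrier G" "K \<in> gone \<pi> \<rho>"
  then have K: "K \<in> \<pi>" "K \<subseteq> X" "K \<inter> \<Union>\<rho> = {}"
    using free_partsD(3)[OF \<pi>] by (auto simp: gone_def)
  have "act g K \<inter> M = {}" if M: "M \<in> \<rho>" for M
  proof -
    have MX: "M \<subseteq> X" and iM: "act (inv g) M \<in> \<rho>"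
      using free_partsD(3,4)[OF \<rho> M] * by auto
    then have "K \<inter> act (inv g) M = {}"
      using K by blast
    then have "act g K \<inter> act g (act (inv g) M) = {}"
      using act_Int_empty_iff[of g K "act (inv g) M"] * K act_subset[OF _ MX] by simp
    then show ?thesis
      using act_act_inv[OF *(1) MX] by simp
  qed
  then show "act g K \<in> gone \<pi> \<rho>"
    using K * free_partsD(4)[OF \<pi>] by (auto simp: gone_def)
qed

text \<open>The union of the smaller family is the disjoint union of the absorbed parts and of the
  larger family. In units of \<open>c\<close> each of the three sizes is congruent modulo
  \<open>d\<close> to its number of orbits, and both valid nonempty families have \<open>n\<close>
  modulo \<open>d\<close> orbits. At the top all orbits are absorbed, and their number can have any
  residue.\<close>

lemma card_gone:
  assumes \<pi>: "valid \<pi>" and \<rho>: "valid \<rho>" and le: "below \<pi> \<rho>" and ne: "\<rho> \<noteq> {}"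
  obtains N where "card (gone \<pi> \<rho>) = c * (d * N)"
proof -
  have \<pi>ne: "\<pi> \<noteq> {}"
    using below_Union[OF le] ne free_partsD(2)[OF valid_free[OF \<rho>]] by fastforce
  have fg: "free_parts (gone \<pi> \<rho>)"
    by (rule free_parts_gone[OF valid_free[OF \<pi>] valid_free[OF \<rho>]])
  have mg: "mod1_parts (gone \<pi> \<rho>)"
    by (rule mod1_parts_subset[OF valid_mod1[OF \<pi>] gone_subset fg])
  have "\<Union>\<pi> = \<Union>(gone \<pi> \<rho>) \<union> \<Union>\<rho>"
  proof
    show "\<Union>\<pi> \<subseteq> \<Union>(gone \<pi> \<rho>) \<union> \<Union>\<rho>"
    proof (rule Union_least)
      fix K assume K: "K \<in> \<pi>"
      show "K \<subseteq> \<Union>(gone \<pi> \<rho>) \<union> \<Union>\<rho>"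
        using below_part_cases[OF valid_free[OF \<pi>] le K]
      proof
        assume "K \<inter> \<Union>\<rho> = {}"
        then show ?thesis
          using K by (auto simp: gone_def)
      qed auto
    qed
    show "\<Union>(gone \<pi> \<rho>) \<union> \<Union>\<rho> \<subseteq> \<Union>\<pi>"
      using below_Union[OF le] gone_subset[of \<pi> \<rho>] by blast
  qed
  moreover have fin: "finite (\<Union>\<pi>)"
    using Union_subset_X[OF valid_free[OF \<pi>] subset_refl] finite_X finite_subset by blast
  ultimately have card: "card (\<Union>\<pi>) = card (\<Union>(gone \<pi> \<rho>)) + card (\<Union>\<rho>)"
    using card_Un_disjoint[OF _ _ Union_gone[OF subset_refl, of \<pi> \<rho>]] by simp
  obtain r t where r: "card \<pi> = c * r" "n = r + d * t"
    using valid_obtain[OF \<pi> \<pi>ne] by metis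
  obtain r' t' where r': "card \<rho> = c * r'" "n = r' + d * t'"
    using valid_obtain[OF \<rho> ne] by metis
  obtain q s where q: "card \<pi> = c * q" "card (\<Union>\<pi>) = c * (q + d * s)"
    using mod1_parts_card[OF valid_mod1[OF \<pi>]] by metis
  obtain q' s' where q': "card \<rho> = c * q'" "card (\<Union>\<rho>) = c * (q' + d * s')"
    using mod1_parts_card[OF valid_mod1[OF \<rho>]] by metis
  obtain q0 s0 where q0: "card (gone \<pi> \<rho>) = c * q0" "card (\<Union>(gone \<pi> \<rho>)) = c * (q0 + d * s0)"
    using mod1_parts_card[OF mg] by metis
  have "q = r" "q' = r'"
    using q q' r r' c_pos by auto
  moreover have "c * (q + d * s) = c * (q0 + d * s0 + (q' + d * s'))"
    using card q q' q0 by (simp add: distrib_left)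
  then have "q + d * s = q0 + d * s0 + (q' + d * s')"
    using c_pos by simp
  ultimately have "q0 + d * (s0 + s' + t) = d * (t' + s)"
    using r r' by (simp add: distrib_left)
  then have "d dvd q0"
    by (metis dvd_add_left_iff dvd_triv_left)
  then show thesis
    using that q0 by (auto elim!: dvdE)
qed

text \<open>If \<open>K\<close> and \<open>act g K\<close> both lie in \<open>M\<close>, then
  \<open>act g M\<close> meets \<open>M\<close>, so they are equal and \<open>g = \<one>\<close> by
  freeness. Hence any set of parts inside \<open>M\<close> may be merged.\<close>

lemma transversal_inside:
  assumes \<pi>: "free_parts \<pi>" and \<rho>: "free_parts \<rho>" and M: "M \<in> \<rho>"
  shows "transversal \<pi> {K \<in> \<pi>. K \<subseteq> M}"
proof -
  have "g = \<one>" if *: "g \<in> carrier G" "K \<in> \<pi>" "K \<subseteq> M" "act g K \<subseteq> M" for g K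
  proof -
    have "act g K \<noteq> {}"
      using free_partsD(2)[OF \<pi> \<open>K \<in> \<pi>\<close>] by (simp add: act_def)
    moreover have "act g K \<subseteq> act g M"
      by (rule act_mono[OF *(3)])
    ultimately have "act g M \<inter> M \<noteq> {}"
      using * by blast
    then have "act g M = M"
      using free_partsD(1)[OF \<rho> free_partsD(4)[OF \<rho> M *(1)] M] by simp
    then show ?thesis
      using free_partsD(5)[OF \<rho> M *(1)] by simp
  qed
  then show ?thesis
    unfolding transversal_def by blast
qed

text \<open>\<open>M\<close> has size 1 modulo \<open>d\<close>, and so has each of the parts that
  make it up.\<close>

lemma card_inside:
  assumes \<pi>: "valid \<pi>" and \<rho>: "valid \<rho>" and le: "below \<pi> \<rho>" and M: "M \<in> \<rho>"
  obtains q where "card {K \<in> \<pi>. K \<subseteq> M} = Suc (d * q)"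
proof -
  have "card M mod d = 1"
    using valid_mod1[OF \<rho>] M by (simp add: mod1_parts_def)
  then have "card {K \<in> \<pi>. K \<subseteq> M} mod d = 1"
    using card_Union_mod1[OF valid_mod1[OF \<pi>], of "{K \<in> \<pi>. K \<subseteq> M}"] below_Union_eq[OF le M] by simp
  then have "card {K \<in> \<pi>. K \<subseteq> M} = Suc (d * (card {K \<in> \<pi>. K \<subseteq> M} div d))"
    using mult_div_mod_eq[of d "card {K \<in> \<pi>. K \<subseteq> M}"] by simp
  then show thesis
    by (rule that)
qed

text \<open>The alternative \<open>\<sigma> = {}\<close> puts no bound on the number of orbits left;
  such a bound enters through the rank equation in \<open>elementary_below\<close>.\<close>

definition elementary where
  "elementary \<pi> \<sigma> \<longleftrightarrow>
     (\<exists>B. transversal \<pi> B \<and> card B = Suc d \<and> \<sigma> = merge \<pi> B) \<or>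
     (\<exists>A. free_parts A \<and> A \<subseteq> \<pi> \<and> card A = c * d \<and> \<sigma> = \<pi> - A) \<or>
     \<sigma> = {}"

lemma elementary_below:
  assumes \<pi>: "valid \<pi>" and \<rho>: "valid \<rho>" and le: "below \<pi> \<rho>" and neq: "\<pi> \<noteq> \<rho>"
  obtains \<sigma> where "valid \<sigma>" "below \<pi> \<sigma>" "below \<sigma> \<rho>" "rnk \<sigma> = Suc (rnk \<pi>)" "elementary \<pi> \<sigma>"
proof -
  note f\<pi> = valid_free[OF \<pi>] and f\<rho> = valid_free[OF \<rho>]
  have \<pi>ne: "\<pi> \<noteq> {}"
    using below_Union[OF le] neq free_partsD(2)[OF f\<rho>] by fastforce
  show thesis
  proof (cases "gone \<pi> \<rho> = {}")
    case True
    \<comment> \<open>Nothing is absorbed, so if each part of the larger family contained a single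
      part of the smaller one, the two families would coincide.\<close>
    have "\<exists>M\<in>\<rho>. card {K \<in> \<pi>. K \<subseteq> M} \<noteq> 1"
    proof (rule ccontr)
      assume "\<not> ?thesis"
      then have one: "card {K \<in> \<pi>. K \<subseteq> M} = 1" if "M \<in> \<rho>" for M
        using that by blast
      have sub: "M \<in> \<pi>" if M: "M \<in> \<rho>" for M
      proof -
        obtain K where "{K \<in> \<pi>. K \<subseteq> M} = {K}"
          using one[OF M] by (auto simp: card_1_singleton_iff)
        then show ?thesis
          using below_Union_eq[OF le M] by auto
      qed
      have "below \<rho> \<pi>"
        unfolding below_def
      proof (intro ballI)
        fix K x assume K: "K \<in> \<pi>" "x \<in> K"
        then have "K \<inter> \<Union>\<rho> \<noteq> {}"
          using True by (auto simp: gone_def)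
        then obtain M where M: "M \<in> \<rho>" "K \<subseteq> M"
          using below_part_cases[OF f\<pi> le K(1)] by blast
        then have "K = M"
          using free_partsD(1)[OF f\<pi> K(1) sub[OF M(1)]] free_partsD(2)[OF f\<pi> K(1)] by blast
        then show "\<exists>M\<in>\<rho>. x \<in> M \<and> M \<subseteq> K"
          using M K by blast
      qed
      then show False
        using below_antisym[OF f\<pi> f\<rho> le] neq by simp
    qed
    then obtain M where M: "M \<in> \<rho>" "card {K \<in> \<pi>. K \<subseteq> M} \<noteq> 1"
      by blast
    obtain q where q: "card {K \<in> \<pi>. K \<subseteq> M} = Suc (d * q)"
      using card_inside[OF \<pi> \<rho> le M(1)] by blast
    then have large: "Suc d \<le> card {K \<in> \<pi>. K \<subseteq> M}"
      using M by (cases q) auto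
    obtain B where B: "B \<subseteq> {K \<in> \<pi>. K \<subseteq> M}" "card B = Suc d"
      by (rule obtain_subset_with_card_n[OF large])
    have tr: "transversal \<pi> B"
      using transversal_subset[OF transversal_inside[OF f\<pi> f\<rho> M(1)] B(1)] .
    show thesis
    proof (rule that)
      show "valid (merge \<pi> B)" "rnk (merge \<pi> B) = Suc (rnk \<pi>)"
        using valid_merge[OF \<pi> tr, of 1] B by auto
      show "below \<pi> (merge \<pi> B)"
        using tr by (intro below_merge[OF f\<pi>]) (simp add: transversal_def)
      show "below (merge \<pi> B) \<rho>"
      proof (rule merge_below[OF f\<pi> f\<rho> le])
        show "B \<subseteq> \<pi>"
          using B by auto
        have "\<Union>B \<subseteq> M"
          using B by auto
        then show "\<Union>B \<inter> \<Union>\<rho> = {} \<or> (\<exists>M\<in>\<rho>. \<Union>B \<subseteq> M)"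
          using M by blast
      qed
      show "elementary \<pi> (merge \<pi> B)"
        using tr B by (auto simp: elementary_def)
    qed
  next
    case False
    have fg: "free_parts (gone \<pi> \<rho>)"
      by (rule free_parts_gone[OF f\<pi> f\<rho>])
    obtain N where N: "card (gone \<pi> \<rho>) = c * N"
      using dvd_card_free_parts[OF fg] by blast
    have "N \<ge> 1"
      using card_free_parts_ge[OF fg False] N c_pos by (cases N) auto
    show thesis
    proof (cases "d \<le> N")
      case True
      obtain A where A: "free_parts A" "A \<subseteq> gone \<pi> \<rho>" "card A = c * d"
        using free_parts_extend[OF fg free_parts_empty, of d] N True by auto
      have A\<pi>: "A \<subseteq> \<pi>"
        using A gone_subset by blast
      show thesis
      proof (rule that)
        show "valid (\<pi> - A)" "rnk (\<pi> - A) = Suc (rnk \<pi>)"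
          using valid_Diff[OF \<pi> \<pi>ne A(1) A\<pi>, of 1] A by auto
        show "below \<pi> (\<pi> - A)"
          by (rule below_Diff)
        show "below (\<pi> - A) \<rho>"
          by (rule Diff_below[OF le Union_gone[OF A(2)]])
        show "elementary \<pi> (\<pi> - A)"
          using A A\<pi> by (auto simp: elementary_def)
      qed
    next
      case False
      \<comment> \<open>A number of absorbed orbits strictly between 0 and \<open>d\<close> is
        possible only at the top, which is then one rank away.\<close>
      have "\<rho> = {}"
      proof (rule ccontr)
        assume "\<rho> \<noteq> {}"
        then obtain N' where "card (gone \<pi> \<rho>) = c * (d * N')"
          using card_gone[OF \<pi> \<rho> le] by blast
        then have "N = d * N'"
          using N c_pos by simp
        then show False
          using \<open>N \<ge> 1\<close> False by (cases N') auto
      qed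
      obtain r t where r: "card \<pi> = c * r" "n = r + d * t" "rnk \<pi> = t"
        using valid_obtain[OF \<pi> \<pi>ne] by metis
      have "r = N"
        using r N c_pos \<open>\<rho> = {}\<close> by (simp add: gone_empty)
      then have "rnk {} = Suc (rnk \<pi>)"
        using rnk_empty[OF r(2), of 0] r \<open>N \<ge> 1\<close> False by simp
      then show thesis
        using that[of "{}"] valid_empty \<open>\<rho> = {}\<close> by (simp add: elementary_def below_empty)
    qed
  qed
qed

subsection \<open>Upper bounds of two elementary steps\<close>

lemma subset_merge: "\<lbrakk>B \<subseteq> \<pi>; B \<inter> sat C = {}\<rbrakk> \<Longrightarrow> B \<subseteq> merge \<pi> C"
  unfolding merge_def by blast

lemma merge_below_cases:
  assumes \<pi>: "free_parts \<pi>" and \<rho>: "free_parts \<rho>" and B: "transversal \<pi> B" "B \<noteq> {}"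
    and le: "below (merge \<pi> B) \<rho>"
  shows "B \<subseteq> gone \<pi> \<rho> \<or> (\<exists>M\<in>\<rho>. \<Union>B \<subseteq> M)"
proof -
  have sub: "B \<subseteq> \<pi>"
    using B by (simp add: transversal_def)
  have "\<Union>B \<inter> \<Union>\<rho> = {} \<or> (\<exists>M\<in>\<rho>. \<Union>B \<subseteq> M)"
    by (rule below_part_cases[OF free_parts_merge[OF \<pi> B] le Union_mem_merge[OF \<pi> sub]])
  then show ?thesis
  proof
    assume *: "\<Union>B \<inter> \<Union>\<rho> = {}"
    have "K \<in> gone \<pi> \<rho>" if "K \<in> B" for K
      using that * sub unfolding gone_def by blast
    then show ?thesis
      by blast
  qed simp
qed

text \<open>If the members of \<open>B\<close> are still parts of \<open>u\<close>, the merge can be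
  repeated there. This settles two steps on disjoint sets of orbits, whether \<open>u\<close> comes
  from a merge or an absorption.\<close>

lemma join_merge:
  assumes w: "valid w" and u: "valid u" and y: "valid y"
    and wu: "below w u" and uy: "below u y"
    and B: "transversal w B" "card B = Suc d" and Bu: "B \<subseteq> u" and By: "below (merge w B) y"
  shows "\<exists>z. valid z \<and> below u z \<and> below (merge w B) z \<and> below z y \<and> rnk z = Suc (rnk u)"
proof (intro exI conjI)
  have ne: "B \<noteq> {}" and Bw: "B \<subseteq> w"
    using B by (auto simp: transversal_def)
  have tr: "transversal u B"
    using B(1) Bu by (simp add: transversal_def)
  show v: "valid (merge u B)" and "rnk (merge u B) = Suc (rnk u)"
    using valid_merge[OF u tr, of 1] B by auto
  show uz: "below u (merge u B)"
    by (rule below_merge[OF valid_free[OF u] Bu])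
  have "\<Union>B \<in> merge u B"
    by (rule Union_mem_merge[OF valid_free[OF u] Bu])
  then show "below (merge w B) (merge u B)"
    using below_trans[OF wu uz] by (intro merge_below[OF valid_free[OF w] valid_free[OF v] _ Bw]) auto
  show "below (merge u B) y"
  proof (rule merge_below[OF valid_free[OF u] valid_free[OF y] uy Bu])
    show "\<Union>B \<inter> \<Union>y = {} \<or> (\<exists>M\<in>y. \<Union>B \<subseteq> M)"
      using merge_below_cases[OF valid_free[OF w] valid_free[OF y] B(1) ne By] Union_gone by blast
  qed
qed

text \<open>The number of parts of \<open>w\<close> inside \<open>M\<close> is 1 modulo
  \<open>d\<close> and exceeds \<open>d + 1\<close>, so it is at least \<open>2 d + 1\<close>. Thus
  \<open>B \<union> C\<close> can be filled up inside \<open>M\<close> to a set \<open>D\<close> of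
  that size, whose merge is the join.\<close>

lemma join_inside:
  assumes w: "valid w" and y: "valid y" and wy: "below w y" and M: "M \<in> y"
    and BC: "B \<union> C \<subseteq> {K \<in> w. K \<subseteq> M}" "Suc d < card (B \<union> C)" "card (B \<union> C) \<le> Suc (d * 2)"
  shows "\<exists>z. valid z \<and> below (merge w B) z \<and> below (merge w C) z \<and> below z y \<and> rnk z = rnk w + 2"
proof -
  have tr: "transversal w {K \<in> w. K \<subseteq> M}"
    by (rule transversal_inside[OF valid_free[OF w] valid_free[OF y] M])
  obtain q where q: "card {K \<in> w. K \<subseteq> M} = Suc (d * q)"
    using card_inside[OF w y wy M] by blast
  have fin: "finite {K \<in> w. K \<subseteq> M}"
    using free_partsD(6)[OF valid_free[OF w]] by simp
  have "d < d * q"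
    using card_mono[OF fin BC(1)] BC(2) q by linarith
  then have "2 \<le> q"
    by simp
  then have "Suc (d * 2) \<le> card {K \<in> w. K \<subseteq> M}"
    using q by simp
  then obtain D where D: "B \<union> C \<subseteq> D" "D \<subseteq> {K \<in> w. K \<subseteq> M}" "card D = Suc (d * 2)"
    using exists_subset_between[OF BC(3) _ BC(1) fin] by blast
  have trD: "transversal w D"
    by (rule transversal_subset[OF tr D(2)])
  then have Dw: "D \<subseteq> w"
    by (simp add: transversal_def)
  have v: "valid (merge w D)" "rnk (merge w D) = rnk w + 2"
    using valid_merge[OF w trD D(3)] by auto
  have wz: "below w (merge w D)"
    by (rule below_merge[OF valid_free[OF w] Dw])
  have "below (merge w E) (merge w D)" if "E \<subseteq> D" for E
    using that Dw Union_mem_merge[OF valid_free[OF w] Dw]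
    by (intro merge_below[OF valid_free[OF w] valid_free[OF v(1)] wz]) (auto intro!: bexI[of _ "\<Union>D"])
  moreover have "below (merge w D) y"
  proof (rule merge_below[OF valid_free[OF w] valid_free[OF y] wy Dw])
    have "\<Union>D \<subseteq> M"
      using D by auto
    then show "\<Union>D \<inter> \<Union>y = {} \<or> (\<exists>M\<in>y. \<Union>D \<subseteq> M)"
      using M by blast
  qed
  ultimately show ?thesis
    using v D by blast
qed

text \<open>Here \<open>2 d + 1\<close> orbits are involved, one more than an absorption of rank 2
  can take. They are merged instead, and the new parts remain for \<open>y\<close> to
  absorb.\<close>

lemma join_transversal_gone:
  assumes w: "valid w" and y: "valid y" and wy: "below w y"
    and D: "transversal w (B \<union> C)" "card (B \<union> C) = Suc (d * 2)" "B \<union> C \<subseteq> gone w y"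
  shows "\<exists>z. valid z \<and> below (merge w B) z \<and> below (merge w C) z \<and> below z y \<and> rnk z = rnk w + 2"
proof -
  have Dw: "B \<union> C \<subseteq> w"
    using D by (simp add: transversal_def)
  have v: "valid (merge w (B \<union> C))" "rnk (merge w (B \<union> C)) = rnk w + 2"
    using valid_merge[OF w D(1,2)] by auto
  have wz: "below w (merge w (B \<union> C))"
    by (rule below_merge[OF valid_free[OF w] Dw])
  have "below (merge w E) (merge w (B \<union> C))" if "E \<subseteq> B \<union> C" for E
  proof (rule merge_below[OF valid_free[OF w] valid_free[OF v(1)] wz])
    show "E \<subseteq> w"
      using that Dw by blast
    show "\<Union>E \<inter> \<Union>(merge w (B \<union> C)) = {} \<or> (\<exists>M\<in>merge w (B \<union> C). \<Union>E \<subseteq> M)"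
      using Union_mem_merge[OF valid_free[OF w] Dw] Union_mono[OF that] by blast
  qed
  moreover have "below (merge w (B \<union> C)) y"
    using Union_gone[OF D(3)] by (intro merge_below[OF valid_free[OF w] valid_free[OF y] wy Dw]) blast
  ultimately show ?thesis
    using v by blast
qed

text \<open>Either \<open>y\<close> absorbs at least \<open>2 d\<close> orbits, and \<open>D\<close>
  is filled up to exactly \<open>2 d\<close>; or their number lies strictly between \<open>d\<close>
  and \<open>2 d\<close>, so \<open>y\<close> is the top and is itself the required element. Making
  \<open>z\<close> disjoint from \<open>D\<close> is enough to place it above any merge or
  absorption inside \<open>D\<close>.\<close>

lemma join_gone:
  assumes w: "valid w" and y: "valid y" and wy: "below w y"
    and D: "free_parts D" "D \<subseteq> gone w y" "c * d < card D" "card D \<le> c * (d * 2)"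
  shows "\<exists>z. valid z \<and> below w z \<and> below z y \<and> \<Union>D \<inter> \<Union>z = {} \<and> rnk z = rnk w + 2"
proof -
  have Dw: "D \<subseteq> w"
    using D(2) gone_subset by blast
  have wne: "w \<noteq> {}"
    using D Dw by auto
  have fg: "free_parts (gone w y)"
    by (rule free_parts_gone[OF valid_free[OF w] valid_free[OF y]])
  obtain N where N: "card (gone w y) = c * N"
    using dvd_card_free_parts[OF fg] by blast
  have "c * d < c * N"
    using card_mono[OF free_partsD(6)[OF fg] D(2)] D(3) N by linarith
  then have dN: "d < N"
    by simp
  show ?thesis
  proof (cases "d * 2 \<le> N")
    case True
    obtain A where A: "free_parts A" "D \<subseteq> A" "A \<subseteq> gone w y" "card A = c * (d * 2)"
      using free_parts_extend[OF fg D(1,2,4)] N True by auto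
    have Aw: "A \<subseteq> w"
      using A(3) gone_subset by blast
    have "\<Union>D \<inter> \<Union>(w - A) = {}"
      using A(2) by (intro Union_Int_empty[OF valid_free[OF w] Dw]) auto
    then show ?thesis
      using valid_Diff[OF w wne A(1) Aw A(4)] below_Diff[of w A]
        Diff_below[OF wy Union_gone[OF A(3)]] by blast
  next
    case False
    have "y = {}"
    proof (rule ccontr)
      assume "y \<noteq> {}"
      then obtain N' where "card (gone w y) = c * (d * N')"
        using card_gone[OF w y wy] by blast
      then have "N = d * N'"
        using N c_pos by simp
      then have "1 < N'" "N' < 2"
        using dN False by auto
      then show False
        by simp
    qed
    obtain r t where r: "card w = c * r" "n = r + d * t" "rnk w = t"
      using valid_obtain[OF w wne] by metis
    have "r = N"
      using r(1) N c_pos \<open>y = {}\<close> by (simp add: gone_empty)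
    then have "rnk {} = rnk w + 2"
      using rnk_empty[OF r(2), of 1] r(3) dN False by simp
    then show ?thesis
      using valid_empty below_empty[of w] below_empty[of "{}"] \<open>y = {}\<close> by (intro exI[of _ "{}"]) simp
  qed
qed

lemma join_merge_gone:
  assumes w: "valid w" and z: "valid z" and wz: "below w z"
    and B: "B \<subseteq> w" "B \<subseteq> D" "\<Union>D \<inter> \<Union>z = {}"
  shows "below (merge w B) z"
  using B by (intro merge_below[OF valid_free[OF w] valid_free[OF z] wz B(1)]) blast

text \<open>The members of \<open>B\<close> share their fate in \<open>y\<close>, so a single
  absorbed translate forces the whole saturation to be absorbed.\<close>

lemma sat_gone:
  assumes w: "free_parts w" and y: "free_parts y" and B: "transversal w B" "B \<noteq> {}"
    and le: "below (merge w B) y" and K: "K \<in> sat B" "K \<in> gone w y"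
  shows "sat B \<subseteq> gone w y"
proof -
  have fg: "free_parts (gone w y)"
    by (rule free_parts_gone[OF w y])
  have sub: "B \<subseteq> w"
    using B by (simp add: transversal_def)
  obtain g K0 where g: "g \<in> carrier G" "K0 \<in> B" "K = act g K0"
    using K by (auto simp: sat_def orbit_def)
  have "act (inv g) K \<in> gone w y"
    using free_partsD(4)[OF fg K(2)] g by simp
  then have K0: "K0 \<in> gone w y"
    using g act_inv_act free_partsD(3)[OF w] sub by (metis subsetD)
  have "B \<subseteq> gone w y"
    using merge_below_cases[OF w y B le]
  proof
    assume "\<exists>M\<in>y. \<Union>B \<subseteq> M"
    then have "K0 \<inter> \<Union>y \<noteq> {}"
      using g free_partsD(2)[OF w] sub by blast
    then show ?thesis
      using K0 by (simp add: gone_def)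
  qed
  then show ?thesis
    by (rule sat_subset[OF fg])
qed

lemma Diff_below_gone:
  assumes w: "free_parts w" and A: "A \<subseteq> w" and le: "below (w - A) y"
  shows "A \<subseteq> gone w y"
proof -
  have "\<Union>A \<inter> \<Union>(w - A) = {}"
    using A by (intro Union_Int_empty[OF w]) auto
  then have "\<Union>A \<inter> \<Union>y = {}"
    using below_Union[OF le] by blast
  then show ?thesis
    using A unfolding gone_def by blast
qed

text \<open>Stable families that meet have a whole orbit in common, which saves \<open>c\<close>
  parts in the union.\<close>

lemma card_Un_free_parts:
  assumes A: "free_parts A" "free_parts A'" and meet: "A \<inter> A' \<noteq> {}"
  shows "card (A \<union> A') + c \<le> card A + card A'"
  using card_Un_Int[of A A'] free_partsD(6)[OF A(1)] free_partsD(6)[OF A(2)]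
    card_free_parts_ge[OF free_parts_Int[OF A] meet] by simp

lemma join_merge_Diff:
  assumes w: "valid w" and y: "valid y"
    and B: "transversal w B" "card B = Suc d" "below (merge w B) y"
    and A: "free_parts A" "A \<subseteq> w" "card A = c * d" "below (w - A) y"
  shows "\<exists>z. valid z \<and> below (merge w B) z \<and> below (w - A) z \<and> below z y \<and> rnk z = rnk w + 2"
proof -
  note fw = valid_free[OF w] and fy = valid_free[OF y]
  have Bw: "B \<subseteq> w" and ne: "B \<noteq> {}"
    using B by (auto simp: transversal_def)
  then have wne: "w \<noteq> {}"
    by auto
  have Agone: "A \<subseteq> gone w y"
    by (rule Diff_below_gone[OF fw A(2,4)])
  have u: "valid (w - A)" "rnk (w - A) = Suc (rnk w)"
    using valid_Diff[OF w wne A(1,2), of 1] A(3) by auto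
  have wy: "below w y"
    by (rule below_trans[OF below_Diff A(4)])
  show ?thesis
  proof (cases "A \<inter> sat B = {}")
    case True
    then have "B \<subseteq> w - A"
      using Bw subset_sat[OF fw Bw] by blast
    then show ?thesis
      using join_merge[OF w u(1) y below_Diff A(4) B(1,2) _ B(3)] u(2) by auto
  next
    case False
    then have sB: "sat B \<subseteq> gone w y"
      using sat_gone[OF fw fy B(1) ne B(3)] Agone by blast
    have fs: "free_parts (sat B)"
      by (rule free_parts_sat[OF fw Bw])
    have cs: "card (sat B) = c * Suc d"
      using card_sat[OF fw B(1)] B(2) by simp
    have fD: "free_parts (sat B \<union> A)"
      by (rule free_parts_Un[OF fw sat_subset[OF fw Bw] fs A(2,1)])
    \<comment> \<open>The common orbit brings the \<open>d + 1\<close> and \<open>d\<close> orbits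
      down to at most \<open>2 d\<close>, the limit for \<open>join_gone\<close>.\<close>
    have "card (sat B \<union> A) + c \<le> card (sat B) + card A"
      using False by (intro card_Un_free_parts[OF fs A(1)]) blast
    then have upper: "card (sat B \<union> A) \<le> c * (d * 2)"
      using cs A(3) by simp
    have "card (sat B) \<le> card (sat B \<union> A)"
      by (rule card_mono[OF free_partsD(6)[OF fD]]) simp
    then have lower: "c * d < card (sat B \<union> A)"
      using cs c_pos by simp
    have "sat B \<union> A \<subseteq> gone w y"
      using sB Agone by blast
    then obtain z where z: "valid z" "below w z" "below z y" "\<Union>(sat B \<union> A) \<inter> \<Union>z = {}"
        "rnk z = rnk w + 2"
      using join_gone[OF w y wy fD _ lower upper] by meson
    have "B \<subseteq> sat B \<union> A"
      using subset_sat[OF fw Bw] by blast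
    then have "below (merge w B) z"
      using join_merge_gone[OF w z(1,2) Bw _ z(4)] by blast
    moreover have "below (w - A) z"
      using z(4) by (intro Diff_below[OF z(2)]) blast
    ultimately show ?thesis
      using z by blast
  qed
qed

text \<open>Disjoint and overlapping absorptions need no distinction: two different families of
  \<open>d\<close> orbits together have more than \<open>d\<close> and at most
  \<open>2 d\<close>.\<close>

lemma join_Diff_Diff:
  assumes w: "valid w" and y: "valid y" and neq: "A \<noteq> A'"
    and A: "free_parts A" "A \<subseteq> w" "card A = c * d" "below (w - A) y"
    and A': "free_parts A'" "A' \<subseteq> w" "card A' = c * d" "below (w - A') y"
  shows "\<exists>z. valid z \<and> below (w - A) z \<and> below (w - A') z \<and> below z y \<and> rnk z = rnk w + 2"
proof -
  note fw = valid_free[OF w]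
  have wy: "below w y"
    by (rule below_trans[OF below_Diff A(4)])
  have fD: "free_parts (A \<union> A')"
    by (rule free_parts_Un[OF fw A(2,1) A'(2,1)])
  have fin: "finite A" "finite A'"
    using free_partsD(6) A(1) A'(1) by blast+
  have "\<not> A' \<subseteq> A"
    using card_subset_eq[OF fin(1), of A'] A(3) A'(3) neq by auto
  then have "A \<subset> A \<union> A'"
    by blast
  then have lower: "c * d < card (A \<union> A')"
    using psubset_card_mono[of "A \<union> A'" A] fin A(3) by simp
  have upper: "card (A \<union> A') \<le> c * (d * 2)"
    using card_Un_le[of A A'] A(3) A'(3) by simp
  have "A \<union> A' \<subseteq> gone w y"
    using Diff_below_gone[OF fw A(2,4)] Diff_below_gone[OF fw A'(2,4)] by blast
  then obtain z where z: "valid z" "below w z" "below z y" "\<Union>(A \<union> A') \<inter> \<Union>z = {}"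
      "rnk z = rnk w + 2"
    using join_gone[OF w y wy fD _ lower upper] by meson
  have "below (w - A) z" "below (w - A') z"
    using z(4) by (intro Diff_below[OF z(2)]; blast)+
  then show ?thesis
    using z by blast
qed

text \<open>The common part \<open>K\<close> forces \<open>B\<close> and \<open>C\<close> to have
  the same fate in \<open>y\<close>. Inside one part of \<open>y\<close> their union is a
  transversal automatically. If they are absorbed, \<open>B\<close> and \<open>C\<close> may
  represent common orbits differently; absorbing everything avoids this, unless more than
  \<open>2 d\<close> orbits are involved.\<close>

lemma join_merge_merge_aux:
  assumes w: "valid w" and y: "valid y" and neq: "B \<noteq> C"
    and B: "transversal w B" "card B = Suc d" "below (merge w B) y"
    and C: "transversal w C" "card C = Suc d" "below (merge w C) y"
    and K: "K \<in> B" "K \<in> C"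
  shows "\<exists>z. valid z \<and> below (merge w B) z \<and> below (merge w C) z \<and> below z y \<and> rnk z = rnk w + 2"
proof -
  note fw = valid_free[OF w] and fy = valid_free[OF y]
  have Bw: "B \<subseteq> w" and Cw: "C \<subseteq> w" and ne: "B \<noteq> {}" "C \<noteq> {}"
    using B C by (auto simp: transversal_def)
  have wy: "below w y"
    by (rule below_trans[OF below_merge[OF fw Bw] B(3)])
  have fin: "finite B" "finite C"
    using Bw Cw free_partsD(6)[OF fw] finite_subset by blast+
  have Kne: "K \<noteq> {}"
    using free_partsD(2)[OF fw] K Bw by blast
  have meet: "B \<inter> C \<noteq> {}"
    using K by blast
  have card_BC: "card (B \<union> C) + card (B \<inter> C) = Suc d + Suc d"
    using card_Un_Int[OF fin] B(2) C(2) by simp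
  have "card (B \<inter> C) \<ge> 1"
    using meet fin by (simp add: Suc_le_eq card_gt_0_iff)
  then have upper1: "card (B \<union> C) \<le> Suc (d * 2)"
    using card_BC by simp
  have "\<not> C \<subseteq> B"
    using card_subset_eq[OF fin(1), of C] B(2) C(2) neq by auto
  then have "B \<subset> B \<union> C"
    by blast
  then have lower1: "Suc d < card (B \<union> C)"
    using psubset_card_mono[of "B \<union> C" B] fin B(2) by simp
  show ?thesis
    using merge_below_cases[OF fw fy B(1) ne(1) B(3)]
  proof
    assume "\<exists>M\<in>y. \<Union>B \<subseteq> M"
    then obtain M where M: "M \<in> y" "\<Union>B \<subseteq> M"
      by blast
    have "K \<notin> gone w y"
      using M K Kne unfolding gone_def by blast
    then obtain M' where M': "M' \<in> y" "\<Union>C \<subseteq> M'"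
      using merge_below_cases[OF fw fy C(1) ne(2) C(3)] K by blast
    have "M \<inter> M' \<noteq> {}"
      using M(2) M'(2) K Kne by blast
    then have "M = M'"
      using free_partsD(1)[OF fy M(1) M'(1)] by simp
    then have "B \<union> C \<subseteq> {K \<in> w. K \<subseteq> M}"
      using M(2) M'(2) Bw Cw by blast
    then show ?thesis
      using join_inside[OF w y wy M(1) _ lower1 upper1] by blast
  next
    assume Bgone: "B \<subseteq> gone w y"
    have fg: "free_parts (gone w y)"
      by (rule free_parts_gone[OF fw fy])
    have sB: "sat B \<subseteq> gone w y"
      by (rule sat_subset[OF fg Bgone])
    have sC: "sat C \<subseteq> gone w y"
      using sat_gone[OF fw fy C(1) ne(2) C(3), of K] subset_sat[OF fw Cw] K Bgone by blast
    have fsB: "free_parts (sat B)" and fsC: "free_parts (sat C)"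
      using free_parts_sat[OF fw Bw] free_parts_sat[OF fw Cw] by auto
    have cs: "card (sat B) = c * Suc d" "card (sat C) = c * Suc d"
      using card_sat[OF fw B(1)] card_sat[OF fw C(1)] B(2) C(2) by auto
    have fD: "free_parts (sat B \<union> sat C)"
      by (rule free_parts_Un[OF fw sat_subset[OF fw Bw] fsB sat_subset[OF fw Cw] fsC])
    have "card (sat B) \<le> card (sat B \<union> sat C)"
      by (rule card_mono[OF free_partsD(6)[OF fD]]) simp
    then have lower: "c * d < card (sat B \<union> sat C)"
      using cs c_pos by simp
    show ?thesis
    proof (cases "card (sat B \<union> sat C) \<le> c * (d * 2)")
      case True
      have "sat B \<union> sat C \<subseteq> gone w y"
        using sB sC by blast
      then obtain z where z: "valid z" "below w z" "below z y" "\<Union>(sat B \<union> sat C) \<inter> \<Union>z = {}"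
          "rnk z = rnk w + 2"
        using join_gone[OF w y wy fD _ lower True] by meson
      have "B \<subseteq> sat B \<union> sat C" "C \<subseteq> sat B \<union> sat C"
        using subset_sat[OF fw Bw] subset_sat[OF fw Cw] by blast+
      then have "below (merge w B) z" "below (merge w C) z"
        using join_merge_gone[OF w z(1,2) Bw _ z(4)] join_merge_gone[OF w z(1,2) Cw _ z(4)] by blast+
      then show ?thesis
        using z by blast
    next
      case False
      \<comment> \<open>Two saturations of \<open>d + 1\<close> orbits each, with more than
        \<open>2 d\<close> orbits together, share fewer than two orbits. So \<open>I\<close> is the
        orbit of \<open>K\<close>, which both sets represent by \<open>K\<close> itself.\<close>
      define I where "I = sat B \<inter> sat C"
      have fI: "free_parts I"
        unfolding I_def by (rule free_parts_Int[OF fsB fsC])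
      have KI: "K \<in> I"
        using K subset_sat[OF fw Bw] subset_sat[OF fw Cw] unfolding I_def by blast
      have "card (sat B \<union> sat C) + card I = c * Suc d + c * Suc d"
        using card_Un_Int[OF free_partsD(6)[OF fsB] free_partsD(6)[OF fsC]] cs by (simp add: I_def)
      then have "card I < c + c"
        using False by (simp add: algebra_simps)
      moreover obtain i where i: "card I = c * i"
        using dvd_card_free_parts[OF fI] by blast
      ultimately have "c * i < c * 2"
        by linarith
      then have "i < 2"
        unfolding mult_less_cancel1 by blast
      then have "card I \<le> c"
        using i by (cases i) auto
      then have I: "orbit K = I"
        using card_subset_eq[OF free_partsD(6)[OF fI] orbit_subset[OF fI KI]]
          card_mono[OF free_partsD(6)[OF fI] orbit_subset[OF fI KI]] card_orbit[OF fI KI] by simp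
      have only_K: "L = K" if L: "L \<in> I" "L \<in> B \<or> L \<in> C" for L
      proof -
        obtain g where g: "g \<in> carrier G" "L = act g K"
          using L(1) I by (auto simp: orbit_def)
        then have "g = \<one>"
          using L(2) K B(1) C(1) unfolding transversal_def by blast
        then show ?thesis
          using g act_one free_partsD(3)[OF fI KI] by simp
      qed
      have "B \<inter> C = {K}"
        using only_K K subset_sat[OF fw Bw] subset_sat[OF fw Cw] unfolding I_def by blast
      then have cD: "card (B \<union> C) = Suc (d * 2)"
        using card_BC by simp
      \<comment> \<open>For representatives taken from different sets: \<open>act g L\<close> lies
        in both saturations, hence so does \<open>L\<close>, and both must be
        \<open>K\<close>.\<close>
      have cross: "g = \<one>" if g: "g \<in> carrier G" and L: "L \<in> E" "act g L \<in> E'"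
        and E: "E = B \<and> E' = C \<or> E = C \<and> E' = B" for g L E E'
      proof -
        have "act g L \<in> sat E"
          using L g by (auto simp: sat_def orbit_def)
        moreover have "act g L \<in> sat E'"
          using L E subset_sat[OF fw Bw] subset_sat[OF fw Cw] by blast
        ultimately have gL: "act g L \<in> I"
          using E unfolding I_def by blast
        have LX: "L \<subseteq> X"
          using L E Bw Cw free_partsD(3)[OF fw] by blast
        have "act (inv g) (act g L) \<in> I"
          using free_partsD(4)[OF fI gL] g by simp
        then have "L \<in> I"
          using act_inv_act[OF g LX] by simp
        then have "L = K" "act g L = K"
          using only_K gL L E by blast+
        then show ?thesis
          using free_partsD(5)[OF fI KI g] by simp
      qed
      have "transversal w (B \<union> C)"
        unfolding transversal_def
      proof (intro conjI ballI impI)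
        show "B \<union> C \<subseteq> w"
          using Bw Cw by blast
        fix g L assume g: "g \<in> carrier G" and L: "L \<in> B \<union> C" "act g L \<in> B \<union> C"
        consider "L \<in> B" "act g L \<in> B" | "L \<in> C" "act g L \<in> C"
          | "L \<in> B" "act g L \<in> C" | "L \<in> C" "act g L \<in> B"
          using L by blast
        then show "g = \<one>"
        proof cases
          case 1
          then show ?thesis
            using B(1) g unfolding transversal_def by blast
        next
          case 2
          then show ?thesis
            using C(1) g unfolding transversal_def by blast
        next
          case 3
          then show ?thesis
            using cross[OF g] by blast
        next
          case 4
          then show ?thesis
            using cross[OF g] by blast
        qed
      qed
      moreover have "B \<union> C \<subseteq> gone w y"
        using Bgone sC subset_sat[OF fw Cw] by blast
      ultimately show ?thesis
        using join_transversal_gone[OF w y wy _ cD] by blast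
    qed
  qed
qed

text \<open>Distinctness is required of the merges, since \<open>B\<close> and \<open>C\<close> may
  differ by a translation only. If an orbit is touched by both, \<open>B\<close> is replaced by the
  translate that contains the representative chosen by \<open>C\<close>.\<close>

lemma join_merge_merge:
  assumes w: "valid w" and y: "valid y" and neq: "merge w B \<noteq> merge w C"
    and B: "transversal w B" "card B = Suc d" "below (merge w B) y"
    and C: "transversal w C" "card C = Suc d" "below (merge w C) y"
  shows "\<exists>z. valid z \<and> below (merge w B) z \<and> below (merge w C) z \<and> below z y \<and> rnk z = rnk w + 2"
proof -
  note fw = valid_free[OF w]
  have Bw: "B \<subseteq> w" and Cw: "C \<subseteq> w"
    using B C by (auto simp: transversal_def)
  show ?thesis
  proof (cases "C \<inter> sat B = {}")
    case True
    have v: "valid (merge w B)" "rnk (merge w B) = Suc (rnk w)"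
      using valid_merge[OF w B(1), of 1] B(2) by auto
    show ?thesis
      using join_merge[OF w v(1) y below_merge[OF fw Bw] B(3) C(1,2) subset_merge[OF Cw True] C(3)] v(2)
      by auto
  next
    case False
    then obtain g K where g: "g \<in> carrier G" "K \<in> B" "act g K \<in> C"
      by (auto simp: sat_def orbit_def)
    have mg: "merge w (act g ` B) = merge w B"
      by (rule merge_act(2)[OF fw Bw g(1)])
    have "act g ` B \<noteq> C"
      using mg neq by auto
    then show ?thesis
      using join_merge_merge_aux[OF w y _ transversal_act(1)[OF fw B(1) g(1)] _ _ C, of "act g K"]
        transversal_act(2)[OF fw B(1) g(1)] B(2,3) g unfolding mg by simp
  qed
qed

text \<open>Excluding the top loses nothing for semimodularity: of two distinct elements of equal
  rank neither is the top, as the other would lie strictly below it.\<close>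

lemma join_elementary:
  assumes w: "valid w" and y: "valid y" and neq: "u \<noteq> v" "u \<noteq> {}" "v \<noteq> {}"
    and u: "elementary w u" "below u y" and v: "elementary w v" "below v y"
  shows "\<exists>z. valid z \<and> below u z \<and> below v z \<and> below z y \<and> rnk z = rnk w + 2"
proof -
  consider
      (mm) B C where "transversal w B" "card B = Suc d" "u = merge w B"
        "transversal w C" "card C = Suc d" "v = merge w C"
    | (md) B A where "transversal w B" "card B = Suc d" "u = merge w B"
        "free_parts A" "A \<subseteq> w" "card A = c * d" "v = w - A"
    | (dm) B A where "transversal w B" "card B = Suc d" "v = merge w B"
        "free_parts A" "A \<subseteq> w" "card A = c * d" "u = w - A"
    | (dd) A A' where "free_parts A" "A \<subseteq> w" "card A = c * d" "u = w - A"
        "free_parts A'" "A' \<subseteq> w" "card A' = c * d" "v = w - A'"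
    using u(1) v(1) neq unfolding elementary_def by metis
  then show ?thesis
  proof cases
    case mm
    then show ?thesis
      using join_merge_merge[OF w y, of B C] neq u(2) v(2) by simp
  next
    case md
    then show ?thesis
      using join_merge_Diff[OF w y, of B A] u(2) v(2) by simp
  next
    case dm
    then show ?thesis
      using join_merge_Diff[OF w y, of B A] u(2) v(2) by auto
  next
    case dd
    moreover from dd have "A \<noteq> A'"
      using neq by auto
    ultimately show ?thesis
      using join_Diff_Diff[OF w y, of A A'] u(2) v(2) by simp
  qed
qed

subsection \<open>The Dowling poset as a ranked poset\<close>

abbreviation L where "L \<equiv> dowling_1mod d G n"

definition point where "point \<pi> = (X - \<Union>\<pi>, \<pi>)"

lemma snd_point [simp]: "snd (point \<pi>) = \<pi>"
  by (simp add: point_def)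

lemma point_eq_iff [simp]: "point \<pi> = point \<rho> \<longleftrightarrow> \<pi> = \<rho>"
  by (auto simp: point_def)

lemma L_le: "le L = dowling_le" and L_eq: "eq L = (=)"
  by (simp_all add: dowling_1mod_def dowling_lattice_def)

lemma le_point_iff:
  assumes \<pi>: "free_parts \<pi>" and \<rho>: "free_parts \<rho>"
  shows "dowling_le (point \<pi>) (point \<rho>) \<longleftrightarrow> below \<pi> \<rho>"
proof
  assume le: "dowling_le (point \<pi>) (point \<rho>)"
  then have sub: "X - \<Union>\<pi> \<subseteq> X - \<Union>\<rho>"
    and cases: "\<And>K. K \<in> \<pi> \<Longrightarrow> K \<subseteq> X - \<Union>\<rho> \<or> (\<exists>M\<in>\<rho>. K \<subseteq> M)"
    by (auto simp: dowling_le_def point_def)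
  show "below \<pi> \<rho>"
    unfolding below_def
  proof (intro ballI)
    fix M x assume M: "M \<in> \<rho>" "x \<in> M"
    then have "x \<in> X" "x \<notin> X - \<Union>\<pi>"
      using sub free_partsD(3)[OF \<rho> M(1)] by auto
    then obtain K where K: "K \<in> \<pi>" "x \<in> K"
      by auto
    have "\<not> K \<subseteq> X - \<Union>\<rho>"
      using K M by auto
    then obtain M' where M': "M' \<in> \<rho>" "K \<subseteq> M'"
      using cases[OF K(1)] by blast
    then have "M' = M"
      using free_partsD(1)[OF \<rho> M'(1) M(1)] K M by blast
    then show "\<exists>K\<in>\<pi>. x \<in> K \<and> K \<subseteq> M"
      using K M' by blast
  qed
next
  assume le: "below \<pi> \<rho>"
  have "K \<subseteq> X - \<Union>\<rho> \<or> (\<exists>M\<in>\<rho>. K \<subseteq> M)" if "K \<in> \<pi>" for K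
    using below_part_cases[OF \<pi> le that] free_partsD(3)[OF \<pi> that] by blast
  moreover have "X - \<Union>\<pi> \<subseteq> X - \<Union>\<rho>"
    using below_Union[OF le] by blast
  ultimately show "dowling_le (point \<pi>) (point \<rho>)"
    by (simp add: dowling_le_def point_def)
qed

text \<open>In units of \<open>c\<close> the ground set has size \<open>n = j + (r + d * s)\<close>,
  where \<open>j\<close> belongs to the complement and \<open>r\<close> counts the orbits of parts.
  So \<open>j\<close> vanishes modulo \<open>d\<close> exactly when \<open>r\<close> agrees with
  \<open>n\<close>.\<close>

lemma cong_complement_iff:
  assumes \<pi>: "mod1_parts \<pi>"
  shows "[card (X - \<Union>\<pi>) div c = 0] (mod d) \<longleftrightarrow> [card \<pi> div c = n] (mod d)"
proof -
  obtain r s where r: "card \<pi> = c * r" "card (\<Union>\<pi>) = c * (r + d * s)"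
    using mod1_parts_card[OF \<pi>] by metis
  have sub: "\<Union>\<pi> \<subseteq> X"
    using \<pi> by (simp add: mod1_parts_def free_parts_def)
  have "c * (r + d * s) \<le> c * n"
    using card_mono[OF finite_X sub] card_X r by simp
  then have le: "r + d * s \<le> n"
    using c_pos by simp
  define j where "j = n - (r + d * s)"
  have n: "n = j + d * s + r"
    using le by (simp add: j_def)
  have "card (X - \<Union>\<pi>) = c * j"
    using card_Diff_subset[OF finite_subset[OF sub finite_X] sub] card_X r
    by (simp add: j_def diff_mult_distrib2)
  then have j: "card (X - \<Union>\<pi>) div c = j" and r': "card \<pi> div c = r"
    using r c_pos by simp_all
  have "[r = n] (mod d) \<longleftrightarrow> d dvd n - r"
    using le cong_altdef_nat[of r n d] cong_sym_eq by (metis add_leE)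
  also have "n - r = j + d * s"
    using n by simp
  also have "d dvd j + d * s \<longleftrightarrow> [j = 0] (mod d)"
    by (simp add: cong_0_iff dvd_add_left_iff)
  finally show ?thesis
    unfolding j r' by simp
qed

lemma act_complement:
  assumes \<pi>: "free_parts \<pi>" and g: "g \<in> carrier G"
  shows "act g (X - \<Union>\<pi>) \<subseteq> X - \<Union>\<pi>"
proof -
  have "act g (X - \<Union>\<pi>) \<inter> K = {}" if K: "K \<in> \<pi>" for K
  proof -
    have KX: "K \<subseteq> X" and "act (inv g) K \<in> \<pi>"
      using free_partsD(3,4)[OF \<pi> K] g by auto
    then have "(X - \<Union>\<pi>) \<inter> act (inv g) K = {}"
      by blast
    then have "act g (X - \<Union>\<pi>) \<inter> act g (act (inv g) K) = {}"
      using act_Int_empty_iff[of g "X - \<Union>\<pi>" "act (inv g) K"] g act_subset[OF _ KX] by simp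
    then show ?thesis
      using act_act_inv[OF g KX] by simp
  qed
  then show ?thesis
    using act_subset[OF g Diff_subset] by blast
qed

lemma cong_1_iff: "[m = 1] (mod d) \<longleftrightarrow> m mod d = 1"
  using d_ge_2 by (simp add: cong_def)

lemma carrier_L: "carrier L = point ` {\<pi>. valid \<pi>}"
proof
  show "point ` {\<pi>. valid \<pi>} \<subseteq> carrier L"
  proof (rule image_subsetI)
    fix \<pi> assume "\<pi> \<in> {\<pi>. valid \<pi>}"
    then have v: "valid \<pi>"
      by simp
    note f = valid_free[OF v]
    have "point \<pi> \<in> dowling_carrier G n"
      using f act_complement[OF f] free_partsD(4,5)[OF f]
      by (auto simp: point_def dowling_carrier_def free_parts_def partition_on_def double_diff
          simp flip: act_def)
    moreover have "[card (X - \<Union>\<pi>) div c = 0] (mod d) \<or> X - \<Union>\<pi> = X"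
      using v cong_complement_iff[OF valid_mod1[OF v]] by (auto simp: valid_def)
    moreover have "\<forall>K\<in>\<pi>. [card K = 1] (mod d)"
      using valid_mod1[OF v] by (simp add: mod1_parts_def cong_1_iff del: One_nat_def)
    ultimately show "point \<pi> \<in> carrier L"
      by (simp add: dowling_1mod_def dowling_lattice_def point_def)
  qed
next
  show "carrier L \<subseteq> point ` {\<pi>. valid \<pi>}"
  proof clarify
    fix J \<pi> assume "(J, \<pi>) \<in> carrier L"
    then have J: "J \<subseteq> X" and part: "partition_on (X - J) \<pi>"
      and free: "\<And>g K. \<lbrakk>g \<in> carrier G; g \<noteq> \<one>; K \<in> \<pi>\<rbrakk> \<Longrightarrow> act g K \<noteq> K \<and> act g K \<in> \<pi>"
      and one: "\<And>K. K \<in> \<pi> \<Longrightarrow> card K mod d = 1"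
      and J_cases: "[card J div c = 0] (mod d) \<or> J = X"
      by (auto simp: dowling_1mod_def dowling_lattice_def dowling_carrier_def act_def cong_1_iff
          simp del: One_nat_def)
    have J_eq: "J = X - \<Union>\<pi>" and sub: "\<Union>\<pi> \<subseteq> X"
      using J partition_onD1[OF part] by auto
    \<comment> \<open>The Dowling condition asserts stability for \<open>g \<noteq> \<one>\<close>
      only.\<close>
    have "act g K \<in> \<pi>" if g: "g \<in> carrier G" "K \<in> \<pi>" for g K
    proof (cases "g = \<one>")
      case True
      then show ?thesis
        using g act_one[OF order_trans[OF Union_upper[OF g(2)] sub]] by simp
    qed (use g free in auto)
    then have f: "free_parts \<pi>"
      using free sub partition_onD2[OF part] partition_onD3[OF part] by (auto simp: free_parts_def)
    have m: "mod1_parts \<pi>"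
      using f one by (simp add: mod1_parts_def)
    have "\<pi> = {}" if "J = X"
      using that part by (simp add: partition_on_empty)
    then have "valid \<pi>"
      using J_cases cong_complement_iff[OF m] m unfolding J_eq valid_def by blast
    then show "(J, \<pi>) \<in> point ` {\<pi>. valid \<pi>}"
      using J_eq by (auto simp: point_def)
  qed
qed

definition singletons where "singletons = (\<lambda>x. {x}) ` X"

lemma valid_singletons: "valid singletons" and rnk_singletons: "rnk singletons = 0"
proof -
  have Un: "\<Union>singletons = X"
    by (auto simp: singletons_def)
  have ne: "singletons \<noteq> {}"
    using n_pos one_closed unfolding singletons_def dowling_ground_def by force
  have "act g {x} \<in> singletons \<and> (g \<noteq> \<one> \<longrightarrow> act g {x} \<noteq> {x})" if g: "g \<in> carrier G" and x: "x \<in> X" for g x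
  proof -
    obtain h i where hi: "x = (h, i)" "h \<in> carrier G" "i \<in> {1..n}"
      using x by (auto simp: dowling_ground_def)
    have "act g {x} = {(g \<otimes> h, i)}"
      by (simp add: act_def dowling_act_def hi)
    moreover have "(g \<otimes> h, i) \<in> X"
      using hi g by (auto simp: dowling_ground_def)
    moreover have "g = \<one>" if "g \<otimes> h = h"
      using that g hi by (metis r_cancel_one)
    ultimately show ?thesis
      using hi by (auto simp: singletons_def)
  qed
  then have f: "free_parts singletons"
    unfolding free_parts_def Un by (auto simp: singletons_def disjoint_def)
  have m: "mod1_parts singletons"
    using f d_ge_2 by (auto simp: mod1_parts_def singletons_def)
  have "card singletons = c * n"
    unfolding singletons_def using card_X by (simp add: card_image)
  then show "valid singletons" "rnk singletons = 0"
    using validI[OF m ne, of n 0] by auto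
qed

lemma singletons_below: "free_parts \<pi> \<Longrightarrow> below singletons \<pi>"
  unfolding below_def singletons_def using free_partsD(3) by blast

lemma ranked: "ranked_poset L (rnk \<circ> snd)"
proof (intro ranked_poset.intro ranked_poset_axioms.intro)
  have le: "le L (point \<pi>) (point \<rho>) \<longleftrightarrow> below \<pi> \<rho>" if "valid \<pi>" "valid \<rho>" for \<pi> \<rho>
    using that le_point_iff valid_free by (simp add: L_le)
  have po: "partial_order L"
  proof
    fix x y z
    show "x .=\<^bsub>L\<^esub> x" and "x .=\<^bsub>L\<^esub> y \<Longrightarrow> y .=\<^bsub>L\<^esub> x" and "\<lbrakk>x .=\<^bsub>L\<^esub> y; y .=\<^bsub>L\<^esub> z\<rbrakk> \<Longrightarrow> x .=\<^bsub>L\<^esub> z"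
      by (simp_all add: L_eq)
    show "le L x x" if "x \<in> carrier L"
      using that le below_refl unfolding carrier_L by auto
    show "x .=\<^bsub>L\<^esub> y" if "le L x y" "le L y x" "x \<in> carrier L" "y \<in> carrier L"
      using that le below_antisym valid_free unfolding carrier_L L_eq by blast
    show "le L x z" if "le L x y" "le L y z" "x \<in> carrier L" "y \<in> carrier L" "z \<in> carrier L"
      using that le below_trans unfolding carrier_L by blast
  next
    fix x y z w
    show "le L x z \<longleftrightarrow> le L y w" if "x .=\<^bsub>L\<^esub> y" "z .=\<^bsub>L\<^esub> w"
      using that by (simp add: L_eq)
    show "(.=\<^bsub>L\<^esub>) = (=)"
      by (rule L_eq)
  qed
  have bot: "least L (point singletons) (carrier L)"
    using le valid_singletons singletons_below valid_free by (auto simp: least_def Lower_def carrier_L)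
  have top: "greatest L (point {}) (carrier L)"
    using le valid_empty by (auto simp: greatest_def Upper_def carrier_L below_empty)
  have "\<exists>x. least L x (carrier L)" "\<exists>x. greatest L x (carrier L)"
    using bot top by blast+
  moreover have "weak_partial_order L"
    using po by (simp add: partial_order_def)
  ultimately show "bounded_poset L"
    by (intro bounded_poset.intro po weak_partial_order_bottom.intro weak_partial_order_top.intro
        weak_partial_order_bottom_axioms.intro weak_partial_order_top_axioms.intro)
  have "{\<pi>. valid \<pi>} \<subseteq> Pow (Pow X)"
    using valid_free free_partsD(3) by blast
  then have "finite {\<pi>. valid \<pi>}"
    using finite_X finite_subset by blast
  then show "finite (carrier L)"
    unfolding carrier_L by (rule finite_imageI)
next
  fix x y assume *: "x \<in> carrier L" "y \<in> carrier L" "lless L x y"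
  then obtain \<pi> \<rho> where x: "x = point \<pi>" "valid \<pi>" and y: "y = point \<rho>" "valid \<rho>"
    by (auto simp: carrier_L)
  have "below \<pi> \<rho>" "\<pi> \<noteq> \<rho>"
    using * x y le_point_iff valid_free by (auto simp: lless_def L_le L_eq)
  then obtain \<sigma> where "valid \<sigma>" "below \<pi> \<sigma>" "below \<sigma> \<rho>" "rnk \<sigma> = Suc (rnk \<pi>)"
    using elementary_below[OF x(2) y(2)] by metis
  then show "\<exists>u\<in>carrier L. lless L x u \<and> le L u y \<and> (rnk \<circ> snd) u = Suc ((rnk \<circ> snd) x)"
    using x y le_point_iff valid_free
    by (intro bexI[of _ "point \<sigma>"]) (auto simp: lless_def L_le L_eq carrier_L)
qed

section \<open>Rank, length and semimodularity\<close>

sublocale L: ranked_poset L "rnk \<circ> snd"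
  by (rule ranked)

lemma bottom_L: "bottom L = point singletons"
proof (rule L.le_antisym)
  show "le L (bottom L) (point singletons)"
    using valid_singletons by (intro L.bottom_lower) (simp add: carrier_L)
  obtain \<pi> where "bottom L = point \<pi>" "valid \<pi>"
    using L.bottom_closed by (auto simp: carrier_L)
  then show "le L (point singletons) (bottom L)"
    using le_point_iff[OF valid_free[OF valid_singletons]] valid_free singletons_below by (simp add: L_le)
qed (use L.bottom_closed valid_singletons in \<open>auto simp: carrier_L\<close>)

lemma top_L: "top L = point {}"
proof (rule L.le_antisym)
  show "le L (point {}) (top L)"
    using valid_empty by (intro L.top_higher) (simp add: carrier_L)
  obtain \<pi> where "top L = point \<pi>" "valid \<pi>"
    using L.top_closed by (auto simp: carrier_L)
  then show "le L (top L) (point {})"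
    using le_point_iff[OF _ free_parts_empty] valid_free below_empty by (simp add: L_le)
qed (use L.top_closed valid_empty in \<open>auto simp: carrier_L\<close>)

lemma rank_L: "x \<in> carrier L \<Longrightarrow> poset_rank L x = rnk (snd x)"
  using L.poset_rank_eq[of x] by (simp add: bottom_L rnk_singletons)

lemma length_L: "poset_length L = rnk {}"
  using L.poset_length_eq by (simp add: bottom_L top_L rnk_singletons)

text \<open>Below \<open>\<sigma>\<close> there is an elementary step to some \<open>\<tau>\<close>
  of the same rank as \<open>\<sigma>\<close>, and strict monotonicity of the rank forces
  \<open>\<tau> = \<sigma>\<close>. So every step of rank one has one of the three explicit
  forms.\<close>

lemma elementary_if_rnk:
  assumes \<pi>: "valid \<pi>" and \<sigma>: "valid \<sigma>" and le: "below \<pi> \<sigma>" and rk: "rnk \<sigma> = Suc (rnk \<pi>)"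
  shows "elementary \<pi> \<sigma>"
proof -
  obtain \<tau> where \<tau>: "valid \<tau>" "below \<tau> \<sigma>" "rnk \<tau> = Suc (rnk \<pi>)" "elementary \<pi> \<tau>"
    using elementary_below[OF \<pi> \<sigma> le] rk by (metis n_not_Suc_n)
  have "\<not> lless L (point \<tau>) (point \<sigma>)"
    using L.rk_less[of "point \<tau>" "point \<sigma>"] \<tau> \<sigma> rk by (auto simp: carrier_L)
  then have "point \<tau> = point \<sigma>"
    using \<tau> \<sigma> le_point_iff valid_free by (simp add: L.lless_eq L_le)
  then show ?thesis
    using \<tau> by simp
qed

lemma totally_semimodular_L: "totally_semimodular L"
proof (rule L.totally_semimodularI)
  fix w u v y
  assume carr: "w \<in> carrier L" "u \<in> carrier L" "v \<in> carrier L" "y \<in> carrier L"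
    and rel: "lless L w u" "lless L w v" "u \<noteq> v" "le L u y" "le L v y"
    and rk: "(rnk \<circ> snd) u = Suc ((rnk \<circ> snd) w)" "(rnk \<circ> snd) v = Suc ((rnk \<circ> snd) w)"
  obtain w' u' v' y' where *: "w = point w'" "u = point u'" "v = point v'" "y = point y'"
    and v: "valid w'" "valid u'" "valid v'" "valid y'"
    using carr by (auto simp: carrier_L)
  note f = v[THEN valid_free]
  have b: "below w' u'" "below w' v'" "below u' y'" "below v' y'" and neq: "u' \<noteq> v'"
    using rel le_point_iff f by (auto simp: * L.lless_eq L_le)
  have r: "rnk u' = Suc (rnk w')" "rnk v' = Suc (rnk w')"
    using rk by (auto simp: *)
  \<comment> \<open>The top lies strictly above \<open>b\<close> and would have larger rank.\<close>
  have not_empty: "a \<noteq> {}" if "valid b" "rnk a = rnk b" "a \<noteq> b" for a b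
  proof
    assume "a = {}"
    then have "lless L (point b) (point a)"
      using that le_point_iff[OF valid_free free_parts_empty] below_empty
      by (auto simp: L.lless_eq L_le)
    then show False
      using L.rk_less[of "point b" "point a"] that valid_empty \<open>a = {}\<close> by (auto simp: carrier_L)
  qed
  have "u' \<noteq> {}" "v' \<noteq> {}"
    using not_empty[of v' u'] not_empty[of u' v'] v r neq by auto
  then obtain z where z: "valid z" "below u' z" "below v' z" "below z y'" "rnk z = rnk w' + 2"
    using join_elementary[OF v(1,4) neq _ _ elementary_if_rnk[OF v(1,2) b(1) r(1)] b(3)
        elementary_if_rnk[OF v(1,3) b(2) r(2)] b(4)] by auto
  then show "\<exists>z\<in>carrier L. le L u z \<and> le L v z \<and> le L z y \<and> (rnk \<circ> snd) z = Suc (Suc ((rnk \<circ> snd) w))"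
    using le_point_iff f valid_free[OF z(1)]
    by (intro bexI[of _ "point z"]) (auto simp: * L_le carrier_L)
qed

lemma rnk_empty_ceiling: "int (rnk {}) = \<lceil>real n / real d\<rceil>"
proof -
  define q where "q = (n + d - 1) div d"
  have d: "0 < d"
    using d_ge_2 by simp
  have "d * q \<le> n + d - 1" "n + d - 1 < d * q + d"
    using times_div_less_eq_dividend[of d "n + d - 1"] dividend_less_times_div[OF d, of "n + d - 1"]
    by (auto simp: q_def)
  then have "d * q < n + d" "n \<le> d * q"
    using d by auto
  then have "real (d * q) < real (n + d)" "real n \<le> real (d * q)"
    using of_nat_less_iff of_nat_le_iff by blast+
  then have "\<lceil>real n / real d\<rceil> = int q"
    using d by (intro ceiling_unique) (simp_all add: field_simps)
  then show ?thesis
    by (simp add: rnk_def q_def)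
qed

lemma rnk_real:
  assumes "valid \<pi>" "\<pi> \<noteq> {}"
  shows "real (rnk \<pi>) = real n / real d - real (card \<pi>) / (real d * real c)"
proof -
  obtain r t where r: "card \<pi> = c * r" "n = r + d * t" "rnk \<pi> = t"
    using valid_obtain[OF assms] by metis
  have "real n = real r + real d * real t"
    by (subst r(2)) simp
  then show ?thesis
    unfolding r(1,3) using c_pos d_ge_2 by (simp add: field_simps)
qed

lemma rank_formula:
  assumes "(J, \<pi>) \<in> carrier L"
  shows "real (poset_rank L (J, \<pi>)) =
    (if J = X then real_of_int \<lceil>real n / real d\<rceil>
     else real n / real d - real (card \<pi>) / (real d * real c))"
proof -
  have J: "J = X - \<Union>\<pi>" and v: "valid \<pi>"
    using assms by (auto simp: carrier_L point_def)
  have "J = X \<longleftrightarrow> \<pi> = {}"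
  proof
    assume "J = X"
    then have "K \<subseteq> {}" if "K \<in> \<pi>" for K
      using J that free_partsD(3)[OF valid_free[OF v] that] by blast
    then show "\<pi> = {}"
      using free_partsD(2)[OF valid_free[OF v]] by blast
  qed (use J in simp)
  moreover have "real (rnk {}) = real_of_int \<lceil>real n / real d\<rceil>"
    unfolding rnk_empty_ceiling[symmetric] by simp
  ultimately show ?thesis
    using rank_L[OF assms] rnk_real[OF v] by simp
qed

end

theorem proposition1p4:
  fixes G :: "('a, 'b) monoid_scheme" and n d :: nat
  assumes "group G" and "finite (carrier G)" and "n \<ge> 1" and "d \<ge> 2"
  shows "totally_semimodular (dowling_1mod d G n)
    \<and> pure_poset (dowling_1mod d G n)
    \<and> (\<forall>(J, \<pi>) \<in> carrier (dowling_1mod d G n).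
         real (poset_rank (dowling_1mod d G n) (J, \<pi>)) =
           (if J = dowling_ground G n then real_of_int \<lceil>real n / real d\<rceil>
            else real n / real d - real (card \<pi>) / (real d * real (order G))))
    \<and> int (poset_length (dowling_1mod d G n)) = \<lceil>real n / real d\<rceil>"
proof -
  interpret dowling G n d
    using assms by (intro dowling.intro dowling_axioms.intro)
  show ?thesis
  proof (intro conjI)
    show "\<forall>(J, \<pi>) \<in> carrier (dowling_1mod d G n).
         real (poset_rank (dowling_1mod d G n) (J, \<pi>)) =
           (if J = dowling_ground G n then real_of_int \<lceil>real n / real d\<rceil>
            else real n / real d - real (card \<pi>) / (real d * real (order G)))"
      using rank_formula by blast
  qed (simp_all add: totally_semimodular_L L.pure rnk_empty_ceiling length_L)
qed

end
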